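(* Let $n\ge 2$ be even and $r\ge 1$, let $V=\{1,\dots,n\}$, $R=\{n+1,\dots,n+r\}$, $V^R=V\cup R$. Let $A^R=(a_{ij})_{i,j\in V^R}$ be a skew-symmetric complex matrix whose column sums are zero (equivalently, $\sum_{j\in V^R}a_{ij}=0$ for every $i\in V^R$), and let $A=(a_{ij})_{i,j\in V}$ be the matrix obtained from $A^R$ by deleting its last $r$ rows and columns. Let $G^R$ and $G$ be the graphs associated to $A^R$ and $A$ (see context). Then for every perfect matching $M_0$ of $G$, $$\mathrm{Pf}(A)=\sum_{F\in \mathcal{F}(M_0)}\mathrm{sgn}\big(\sigma_{M_0(F\setminus M_0)}\big)\prod_{e\in F\setminus M_0}a_e,$$ where $\mathcal{F}(M_0)$ is the set of spanning forests of $G^R$ compatible with $M_0$ satisfying Condition (C), $a_e=a_{uv}$ for the oriented edge $e=(u,v)$, and $\sigma_{M_0(F\setminus M_0)}$ is the permutation defined in the context.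
   Context: Pfaffian: $\mathrm{Pf}(A)=\frac{1}{2^{n/2}(n/2)!}\sum_{\sigma\in S_n}\mathrm{sgn}(\sigma)a_{\sigma(1)\sigma(2)}\cdots a_{\sigma(n-1)\sigma(n)}$. The graph $G^R$ has vertex set $V^R$ and an (undirected) edge $ij$ whenever $a_{ij}\neq 0$; $G$ is the analogous graph on $V$ built from $A$. A perfect matching of $G$ is a set of edges of $G$ such that each vertex of $V$ lies in exactly one of them. A spanning forest of $G^R$ is a set $F$ of oriented edges of $G^R$ containing no cycle such that each vertex of $V$ has exactly one outgoing edge in $F$ and vertices of $R$ have none; thus every connected component is a tree containing exactly one vertex of $R$ (its root), with edges oriented towards the root. A leaf is a vertex of $V$ with no incoming edge. $F$ is compatible with a perfect matching $M_0$ of $G$ if (forgetting orientations) $F$ contains all $n/2$ edges of $M_0$ (its other $n/2$ edges are then not in $M_0$); $F\setminus M_0$ denotes the oriented edges of $F$ not in $M_0$. Sign: the orientation of $F$ orients each edge of $M_0$; write the oriented matching edges as $(i_1,i_2),(i_3,i_4),\dots,(i_{n-1},i_n)$ (in any order of the pairs); $\sigma_{M_0(F\setminus M_0)}$ is the permutation $k\mapsto i_k$ of $\{1,\dots,n\}$ (its sign does not depend on the order of the pairs). Trimming algorithm, applied to a spanning forest $F$ compatible with $M_0$: set $F_1=F$. At step $i\ge1$, let $\ell^i$ be the leaf of $F_i$ (vertex of $V$ having an outgoing edge in $F_i$ and no incoming edge in $F_i$) with the largest label. Follow the unique directed path in $F_i$ from $\ell^i$ towards the root of its component, stopping at the first vertex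 reached which is either a vertex of $R$, or a fork (a vertex with more than one incoming edge in $F_i$), or a vertex with label smaller than $\ell^i$. This gives a path $\lambda_{\ell^i}$ of length $\ge1$. Set $F_{i+1}=F_i\setminus\lambda_{\ell^i}$; stop when $F_{i+1}$ is empty, say after $N$ steps. Condition (C): each of the paths $\lambda_{\ell^1},\dots,\lambda_{\ell^N}$ has even length and its first edge is an edge of $M_0$. *)

theory Defs
  imports Complex_Main "HOL-Combinatorics.Permutations" "HOL-Library.Product_Lexorder"
begin

text \<open>Vertices are natural numbers; V = {1..n}, R = {n+1..n+r}.
  The matrix A^R is a function a :: nat => nat => complex (only its values on V^R matter).\<close>

definition pfaffian :: "nat \<Rightarrow> (nat \<Rightarrow> nat \<Rightarrow> complex) \<Rightarrow> complex" where
  "pfaffian n a =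
     (1 / (2 ^ (n div 2) * fact (n div 2))) *
     (\<Sum>\<sigma> | \<sigma> permutes {1..n}.
        of_int (sign \<sigma>) * (\<Prod>k<n div 2. a (\<sigma> (2*k+1)) (\<sigma> (2*k+2))))"

definition graph_edges :: "nat set \<Rightarrow> (nat \<Rightarrow> nat \<Rightarrow> complex) \<Rightarrow> nat set set" where
  "graph_edges W a = {{i, j} | i j. i \<in> W \<and> j \<in> W \<and> i \<noteq> j \<and> a i j \<noteq> 0}"

definition perfect_matching :: "nat set \<Rightarrow> nat set set \<Rightarrow> nat set set \<Rightarrow> bool" where
  "perfect_matching W E M \<longleftrightarrow> M \<subseteq> E \<and> (\<forall>v\<in>W. \<exists>!e. e \<in> M \<and> v \<in> e)"

definition spanning_forest ::
  "nat set \<Rightarrow> nat set \<Rightarrow> (nat \<Rightarrow> nat \<Rightarrow> complex) \<Rightarrow> (nat \<times> nat) set \<Rightarrow> bool" where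
  "spanning_forest V R a F \<longleftrightarrow>
     F \<subseteq> {(i, j). i \<in> V \<union> R \<and> j \<in> V \<union> R \<and> i \<noteq> j \<and> a i j \<noteq> 0} \<and>
     acyclic F \<and>
     (\<forall>v\<in>V. \<exists>!w. (v, w) \<in> F) \<and>
     (\<forall>v\<in>R. \<forall>w. (v, w) \<notin> F)"

definition compatible :: "nat set set \<Rightarrow> (nat \<times> nat) set \<Rightarrow> bool" where
  "compatible M0 F \<longleftrightarrow> (\<forall>e\<in>M0. \<exists>u v. (u, v) \<in> F \<and> e = {u, v})"

definition F_minus :: "nat set set \<Rightarrow> (nat \<times> nat) set \<Rightarrow> (nat \<times> nat) set" where
  "F_minus M0 F = {(u, v). (u, v) \<in> F \<and> {u, v} \<notin> M0}"

text \<open>The permutation k |-> i_k, where the oriented matching edges (i_1,i_2),(i_3,i_4),...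
  are listed in a fixed (lexicographic) order; the sign does not depend on this order.\<close>
definition matching_perm :: "nat set set \<Rightarrow> (nat \<times> nat) set \<Rightarrow> nat \<Rightarrow> nat" where
  "matching_perm M0 F =
     (let ps = sorted_list_of_set {(u, v). (u, v) \<in> F \<and> {u, v} \<in> M0};
          xs = concat (map (\<lambda>(u, v). [u, v]) ps)
      in (\<lambda>k. if 1 \<le> k \<and> k \<le> length xs then xs ! (k - 1) else k))"

definition out_nb :: "(nat \<times> nat) set \<Rightarrow> nat \<Rightarrow> nat" where
  "out_nb E x = (THE y. (x, y) \<in> E)"

definition leaves :: "nat set \<Rightarrow> (nat \<times> nat) set \<Rightarrow> nat set" where
  "leaves V E = {v \<in> V. (\<exists>w. (v, w) \<in> E) \<and> (\<forall>u. (u, v) \<notin> E)}"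

definition trim_leaf :: "nat set \<Rightarrow> (nat \<times> nat) set \<Rightarrow> nat" where
  "trim_leaf V E = Max (leaves V E)"

definition stops :: "nat set \<Rightarrow> (nat \<times> nat) set \<Rightarrow> nat \<Rightarrow> nat \<Rightarrow> bool" where
  "stops R E l x \<longleftrightarrow> x \<in> R \<or> card {u. (u, x) \<in> E} > 1 \<or> x < l"

definition path_vtx :: "(nat \<times> nat) set \<Rightarrow> nat \<Rightarrow> nat \<Rightarrow> nat" where
  "path_vtx E l j = (out_nb E ^^ j) l"

definition path_len :: "nat set \<Rightarrow> (nat \<times> nat) set \<Rightarrow> nat \<Rightarrow> nat" where
  "path_len R E l = (LEAST k. 1 \<le> k \<and> stops R E l (path_vtx E l k))"

definition path_edges :: "nat set \<Rightarrow> (nat \<times> nat) set \<Rightarrow> nat \<Rightarrow> (nat \<times> nat) set" where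
  "path_edges R E l =
     {(path_vtx E l j, path_vtx E l (Suc j)) | j. j < path_len R E l}"

definition trim_step :: "nat set \<Rightarrow> nat set \<Rightarrow> (nat \<times> nat) set \<Rightarrow> (nat \<times> nat) set" where
  "trim_step V R E = E - path_edges R E (trim_leaf V E)"

definition condition_C ::
  "nat set \<Rightarrow> nat set \<Rightarrow> nat set set \<Rightarrow> (nat \<times> nat) set \<Rightarrow> bool" where
  "condition_C V R M0 F \<longleftrightarrow>
     (\<forall>i. let E = (trim_step V R ^^ i) F; l = trim_leaf V E in
        E \<noteq> {} \<longrightarrow> even (path_len R E l) \<and> {l, out_nb E l} \<in> M0)"

end

theory Submission
  imports Defs
begin

text \<open>
  Regard \<open>Pf\<close> as an alternating multilinear form in vectors, one per vertex, where the form
  \<open>\<omega>\<close> given by \<open>a\<close> has the sum of all vectors (those of \<open>R\<close> included) in its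
  radical. If \<open>{v, v'}\<close> is an edge of \<open>M0\<close> and \<open>\<rho>\<close> is the sum of the roots, expanding along
  \<open>v'\<close>, substituting \<open>\<omega>(v', v) = - (\<Sum>y. \<omega>(v', y)) - \<omega>(v', \<rho>)\<close> and subtracting
  \<open>Pf(v', v', \<dots>) = 0\<close> gives
  \<open>Pf(v, v', rest) = (\<Sum>y. \<omega>(v', y) Pf(rest[y := y + v + v'])) + \<omega>(v', \<rho>) Pf(rest)\<close>.
  The radical condition persists for the merged vectors, so the step can be iterated, and the
  choices of \<open>y\<close> spell out alternating paths \<open>v, v', y, y', \<dots>\<close> that end as soon as
  they meet the roots or an earlier path. If each path starts at the smallest vertex not yet
  covered, as in Wilson's algorithm, then the trimming algorithm removes exactly these paths in
  reverse order: its leaves decrease, and Condition (C), together with compatibility, says that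
  every path is alternating of even length.
\<close>

section \<open>Expansion of the Pfaffian along a row\<close>

text \<open>The substitution is what yields forests instead of arbitrary successor maps. In the
  middle of a branch the vector \<open>v\<close> is the sum of all vertices of that branch up to its
  tip, so \<open>\<omega>(v', v)\<close> collects exactly the edges from \<open>v'\<close> back into
  the current branch, the ones that would close a cycle; they are traded for edges to all other
  vertices. The algebra does not care where a new branch starts. The choice of the smallest free
  vertex is dictated by the trimming rule, which picks the largest leaf and compares labels only
  with that leaf. Zero entries are invisible to the recursion. The growing process therefore admits
  every edge, and forests using an edge with a zero entry are discarded only at the end, where their
  weight is 0. The sign of a permutation does not restrict well to shorter lists, so the induction
  carries a product of orientation signs relative to a fixed listing of the matching, converted into
  the sign of a permutation afterwards.\<close>

definition pf_term :: "nat \<Rightarrow> (nat \<Rightarrow> nat \<Rightarrow> complex) \<Rightarrow> (nat \<Rightarrow> nat) \<Rightarrow> complex" where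
  "pf_term m b \<sigma> = of_int (sign \<sigma>) * (\<Prod>k<m. b (\<sigma> (2*k+1)) (\<sigma> (2*k+2)))"

lemma pfaffian_pf_term:
  "pfaffian (2*m) b = (1 / (2 ^ m * fact m)) * (\<Sum>\<sigma> | \<sigma> permutes {1..2*m}. pf_term m b \<sigma>)"
  by (simp add: pfaffian_def pf_term_def)

lemma pfaffian_cong:
  assumes "\<And>i j. i \<in> {1..n} \<Longrightarrow> j \<in> {1..n} \<Longrightarrow> b i j = c i j"
  shows "pfaffian n b = pfaffian n c"
proof -
  have "b (\<sigma> (2*k+1)) (\<sigma> (2*k+2)) = c (\<sigma> (2*k+1)) (\<sigma> (2*k+2))"
    if "\<sigma> permutes {1..n}" "k < n div 2" for \<sigma> k
  proof -
    have "2*k+1 \<in> {1..n}" "2*k+2 \<in> {1..n}" using that by auto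
    then show ?thesis using that(1) by (intro assms) (simp_all only: permutes_in_image)
  qed
  then show ?thesis
    unfolding pfaffian_def by (intro arg_cong2[where f = "(*)"] refl sum.cong prod.cong) auto
qed

lemma pfaffian_permute:
  assumes "\<tau> permutes {1..n}"
  shows "pfaffian n (\<lambda>i j. b (\<tau> i) (\<tau> j)) = of_int (sign \<tau>) * pfaffian n b"
proof -
  let ?P = "{\<sigma>. \<sigma> permutes {1..n}}"
  let ?w = "\<lambda>\<sigma>. (\<Prod>k<n div 2. b (\<sigma> (2*k+1)) (\<sigma> (2*k+2)))"
  have s: "sign (\<tau> \<circ> \<sigma>) = sign \<tau> * sign \<sigma>" if "\<sigma> \<in> ?P" for \<sigma>
    using that assms by (intro sign_compose) (auto intro: permutes_imp_permutation)
  have "(\<Sum>\<sigma>\<in>?P. of_int (sign \<sigma>) * ?w \<sigma>) = (\<Sum>\<sigma>\<in>?P. of_int (sign (\<tau> \<circ> \<sigma>)) * ?w (\<tau> \<circ> \<sigma>))"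
    by (rule setum_permutations_compose_left[OF assms])
  also have "\<dots> = of_int (sign \<tau>) * (\<Sum>\<sigma>\<in>?P. of_int (sign \<sigma>) * ?w (\<tau> \<circ> \<sigma>))"
    unfolding sum_distrib_left by (intro sum.cong refl) (simp add: s)
  finally have "(\<Sum>\<sigma>\<in>?P. of_int (sign \<sigma>) * ?w (\<tau> \<circ> \<sigma>))
      = of_int (sign \<tau>) * (\<Sum>\<sigma>\<in>?P. of_int (sign \<sigma>) * ?w \<sigma>)"
    by (simp flip: mult.assoc of_int_mult)
  then show ?thesis
    unfolding pfaffian_def by simp
qed

text \<open>Exchanging the two places of one pair flips the sign of the permutation and, by
  skewness, the sign of exactly one factor.\<close>

lemma pf_term_swap_in_pair:
  assumes skew: "\<And>i j. i \<in> {1..2*m} \<Longrightarrow> j \<in> {1..2*m} \<Longrightarrow> b i j = - b j i"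
    and \<sigma>: "\<sigma> permutes {1..2*m}" and k: "k < m"
  shows "pf_term m b (\<sigma> \<circ> transpose (2*k+1) (2*k+2)) = pf_term m b \<sigma>"
proof -
  let ?t = "transpose (2*k+1) (2*k+2)"
  have sg: "sign (\<sigma> \<circ> ?t) = - sign \<sigma>"
    using \<sigma> by (subst sign_compose)
      (auto intro: permutes_imp_permutation permutation_swap_id simp: sign_swap_id)
  have other: "b ((\<sigma> \<circ> ?t) (2*j+1)) ((\<sigma> \<circ> ?t) (2*j+2)) = b (\<sigma> (2*j+1)) (\<sigma> (2*j+2))"
    if "j \<noteq> k" for j
  proof -
    have "?t (2*j+1) = 2*j+1" "?t (2*j+2) = 2*j+2"
      using that by (auto simp: transpose_def)
    then show ?thesis by simp
  qed
  have "2*k+1 \<in> {1..2*m}" "2*k+2 \<in> {1..2*m}" using k by auto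
  then have in_range: "\<sigma> (2*k+1) \<in> {1..2*m}" "\<sigma> (2*k+2) \<in> {1..2*m}"
    by (simp_all only: permutes_in_image[OF \<sigma>])
  have "(\<Prod>j<m. b ((\<sigma> \<circ> ?t) (2*j+1)) ((\<sigma> \<circ> ?t) (2*j+2)))
      = b ((\<sigma> \<circ> ?t) (2*k+1)) ((\<sigma> \<circ> ?t) (2*k+2)) *
        (\<Prod>j\<in>{..<m}-{k}. b ((\<sigma> \<circ> ?t) (2*j+1)) ((\<sigma> \<circ> ?t) (2*j+2)))"
    using k by (subst prod.remove[of _ k]) auto
  also have "\<dots> = - (b (\<sigma> (2*k+1)) (\<sigma> (2*k+2)) *
        (\<Prod>j\<in>{..<m}-{k}. b (\<sigma> (2*j+1)) (\<sigma> (2*j+2))))"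
    using skew[OF in_range] other by simp
  also have "b (\<sigma> (2*k+1)) (\<sigma> (2*k+2)) * (\<Prod>j\<in>{..<m}-{k}. b (\<sigma> (2*j+1)) (\<sigma> (2*j+2)))
      = (\<Prod>j<m. b (\<sigma> (2*j+1)) (\<sigma> (2*j+2)))"
    using k by (subst prod.remove[of "{..<m}" k]) auto
  finally show ?thesis
    unfolding pf_term_def sg by simp
qed

text \<open>Exchanging two different pairs is a product of two transpositions, hence even, and
  merely permutes the factors.\<close>

lemma pf_term_swap_pairs:
  assumes \<sigma>: "\<sigma> permutes {1..2*m}" and k: "k < m" and l: "l < m"
  shows "pf_term m b (\<sigma> \<circ> (transpose (2*k+1) (2*l+1) \<circ> transpose (2*k+2) (2*l+2))) = pf_term m b \<sigma>"
proof (cases "k = l")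
  case False
  let ?t = "transpose (2*k+1) (2*l+1) \<circ> transpose (2*k+2) (2*l+2)"
  have "sign (\<sigma> \<circ> ?t) = sign \<sigma> * sign ?t"
    using \<sigma> by (intro sign_compose permutation_compose permutation_swap_id)
      (auto intro: permutes_imp_permutation)
  also have "sign ?t = 1"
    using False by (subst sign_compose) (auto simp: permutation_swap_id sign_swap_id)
  finally have sg: "sign (\<sigma> \<circ> ?t) = sign \<sigma>" by (simp only: mult_1_right)
  have tr: "?t (2*j+1) = 2 * transpose k l j + 1 \<and> ?t (2*j+2) = 2 * transpose k l j + 2" for j
    using False by (auto simp: transpose_def)
  have "(\<Prod>j<m. b ((\<sigma> \<circ> ?t) (2*j+1)) ((\<sigma> \<circ> ?t) (2*j+2)))
      = (\<Prod>j<m. b (\<sigma> (2 * transpose k l j + 1)) (\<sigma> (2 * transpose k l j + 2)))"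
    using tr by (intro prod.cong) (simp_all add: o_def)
  also have "\<dots> = (\<Prod>j<m. b (\<sigma> (2 * j + 1)) (\<sigma> (2 * j + 2)))"
    by (rule prod.reindex_bij_betw[of "transpose k l"])
      (use k l in \<open>auto intro!: permutes_imp_bij permutes_swap_id\<close>)
  finally show ?thesis
    unfolding pf_term_def sg by simp
qed simp

text \<open>The two symmetries above act transitively on the places, so the place holding the value
  \<open>c\<close> can be normalised to \<open>2*m-1\<close>.\<close>

lemma sum_pf_term_position:
  assumes skew: "\<And>i j. i \<in> {1..2*m} \<Longrightarrow> j \<in> {1..2*m} \<Longrightarrow> b i j = - b j i"
    and i: "i \<in> {1..2*m}" and m: "m > 0"
  shows "(\<Sum>\<sigma> | \<sigma> permutes {1..2*m}. if \<sigma> i = c then pf_term m b \<sigma> else 0)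
       = (\<Sum>\<sigma> | \<sigma> permutes {1..2*m}. if \<sigma> (2*m-1) = c then pf_term m b \<sigma> else 0)"
proof -
  let ?S = "\<lambda>i. \<Sum>\<sigma> | \<sigma> permutes {1..2*m}. if \<sigma> i = c then pf_term m b \<sigma> else 0"
  have pairs: "?S (2*k+1) = ?S (2*m-1)" if k: "k < m" for k
  proof -
    let ?t = "transpose (2*k+1) (2*(m-1)+1) \<circ> transpose (2*k+2) (2*(m-1)+2)"
    have t: "?t permutes {1..2*m}"
      using k m by (intro permutes_compose permutes_swap_id) auto
    have te: "?t (2*m-1) = 2*k+1"
      using m k by (auto simp: transpose_def)
    have "?S (2*k+1) = (\<Sum>\<sigma> | \<sigma> permutes {1..2*m}. if (\<sigma> \<circ> ?t) (2*m-1) = c then pf_term m b (\<sigma> \<circ> ?t) else 0)"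
    proof (intro sum.cong refl)
      fix \<sigma> assume "\<sigma> \<in> {\<sigma>. \<sigma> permutes {1..2*m}}"
      then have "pf_term m b (\<sigma> \<circ> ?t) = pf_term m b \<sigma>"
        using k m by (intro pf_term_swap_pairs) auto
      moreover have "(\<sigma> \<circ> ?t) (2*m-1) = \<sigma> (2*k+1)"
        using arg_cong[OF te, of \<sigma>] by (simp only: comp_apply)
      ultimately show "(if \<sigma> (2*k+1) = c then pf_term m b \<sigma> else 0)
          = (if (\<sigma> \<circ> ?t) (2*m-1) = c then pf_term m b (\<sigma> \<circ> ?t) else 0)"
        by (simp only:)
    qed
    also have "\<dots> = ?S (2*m-1)"
      by (rule sum_permutations_compose_right[OF t, symmetric])
    finally show ?thesis .
  qed
  have inpair: "?S (2*k+2) = ?S (2*k+1)" if k: "k < m" for k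
  proof -
    let ?t = "transpose (2*k+1) (2*k+2)"
    have t: "?t permutes {1..2*m}"
      using k m by (intro permutes_swap_id) auto
    have "?S (2*k+2) = (\<Sum>\<sigma> | \<sigma> permutes {1..2*m}. if (\<sigma> \<circ> ?t) (2*k+1) = c then pf_term m b (\<sigma> \<circ> ?t) else 0)"
    proof (intro sum.cong refl)
      fix \<sigma> assume "\<sigma> \<in> {\<sigma>. \<sigma> permutes {1..2*m}}"
      then have "pf_term m b (\<sigma> \<circ> ?t) = pf_term m b \<sigma>"
        using k by (intro pf_term_swap_in_pair[OF skew]) auto
      moreover have "(\<sigma> \<circ> ?t) (2*k+1) = \<sigma> (2*k+2)"
        by simp
      ultimately show "(if \<sigma> (2*k+2) = c then pf_term m b \<sigma> else 0)
          = (if (\<sigma> \<circ> ?t) (2*k+1) = c then pf_term m b (\<sigma> \<circ> ?t) else 0)"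
        by (simp only:)
    qed
    also have "\<dots> = ?S (2*k+1)"
      by (rule sum_permutations_compose_right[OF t, symmetric])
    finally show ?thesis .
  qed
  show ?thesis
  proof (cases "even i")
    case True
    then obtain l where "i = 2*l" by (elim evenE)
    then have "i = 2*(l-1)+2" "l-1 < m" using i by auto
    then obtain k where "i = 2*k+2" "k < m" by blast
    then show ?thesis using inpair pairs by simp
  next
    case False
    then obtain k where "i = 2*k+1" "k < m"
      using i by (auto elim!: oddE)
    then show ?thesis using pairs by simp
  qed
qed

text \<open>In the term for \<open>j\<close>, index \<open>n+2\<close> takes over the place of
  \<open>j\<close> instead of the remaining rows being renumbered. Each such relabelling is a single
  transposition, so all these terms carry the same minus sign rather than alternating ones.\<close>

lemma pfaffian_expand:
  assumes "even n" and skew: "\<And>i j. i \<in> {1..n+2} \<Longrightarrow> j \<in> {1..n+2} \<Longrightarrow> b i j = - b j i"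
  shows "pfaffian (n+2) b = b (n+1) (n+2) * pfaffian n b
     - (\<Sum>j\<in>{1..n}. b (n+1) j *
          pfaffian n (\<lambda>i k. b (transpose j (n+2) i) (transpose j (n+2) k)))"
proof -
  obtain m where n: "n = 2 * m" using \<open>even n\<close> by (auto elim: evenE)
  let ?M = "Suc m"
  let ?T = "pf_term ?M b"
  let ?S = "{1..2 * ?M}"
  let ?c = "2*m+1"
  have skew': "\<And>i j. i \<in> ?S \<Longrightarrow> j \<in> ?S \<Longrightarrow> b i j = - b j i"
    by (rule skew) (auto simp: n)
  \<comment> \<open>Every permutation takes the value \<open>?c\<close> at exactly one place. Since
    \<open>2 * ?M - 1 = ?c\<close>, moving that place to \<open>2 * ?M - 1\<close> leaves only
    permutations fixing \<open>?c\<close>, counted \<open>2 * ?M\<close> times.\<close>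
  have split: "?T \<sigma> = (\<Sum>i\<in>?S. if \<sigma> i = ?c then ?T \<sigma> else 0)" if "\<sigma> permutes ?S" for \<sigma>
  proof -
    have "\<sigma> i = ?c \<longleftrightarrow> i = inv \<sigma> ?c" for i
      using permutes_inv_eq[OF that, of ?c i] by blast
    then have "(\<Sum>i\<in>?S. if \<sigma> i = ?c then ?T \<sigma> else 0) = (\<Sum>i\<in>?S. if i = inv \<sigma> ?c then ?T \<sigma> else 0)"
      by (simp only:)
    also have "\<dots> = ?T \<sigma>"
      using permutes_in_image[OF permutes_inv[OF that], of ?c] by (subst sum.delta) auto
    finally show ?thesis by simp
  qed
  have "(\<Sum>\<sigma> | \<sigma> permutes ?S. ?T \<sigma>) = (\<Sum>\<sigma> | \<sigma> permutes ?S. \<Sum>i\<in>?S. if \<sigma> i = ?c then ?T \<sigma> else 0)"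
    by (intro sum.cong refl split) simp
  also have "\<dots> = (\<Sum>i\<in>?S. \<Sum>\<sigma> | \<sigma> permutes ?S. if \<sigma> i = ?c then ?T \<sigma> else 0)"
    by (rule sum.swap)
  also have "\<dots> = (\<Sum>i\<in>?S. \<Sum>\<sigma> | \<sigma> permutes ?S. if \<sigma> (2 * ?M - 1) = ?c then ?T \<sigma> else 0)"
    by (intro sum.cong refl sum_pf_term_position skew') auto
  also have "\<dots> = of_nat (2 * ?M) * (\<Sum>\<sigma> | \<sigma> permutes ?S. if \<sigma> ?c = ?c then ?T \<sigma> else 0)"
    by simp
  also have "(\<Sum>\<sigma> | \<sigma> permutes ?S. if \<sigma> ?c = ?c then ?T \<sigma> else 0)
      = (\<Sum>\<sigma> | \<sigma> permutes ?S \<and> \<sigma> ?c = ?c. ?T \<sigma>)"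
    by (subst sum.inter_filter[symmetric]) (auto simp: finite_permutations)
  \<comment> \<open>Fixing \<open>?c\<close> leaves the permutations of the other indices; they are
    then sorted by the value \<open>j\<close> at place \<open>2*m+2\<close>, the partner of
    \<open>?c\<close>.\<close>
  also have "{\<sigma>. \<sigma> permutes ?S \<and> \<sigma> ?c = ?c} = {\<sigma>. \<sigma> permutes insert (2*m+2) {1..2*m}}"
  proof -
    have "?S = insert ?c (insert (2*m+2) {1..2*m})" by auto
    then show ?thesis
      by (auto intro: permutes_superset permutes_subset simp: permutes_not_in)
  qed
  also have "(\<Sum>\<sigma>\<in>\<dots>. ?T \<sigma>)
     = (\<Sum>j\<in>insert (2*m+2) {1..2*m}. \<Sum>\<sigma> | \<sigma> permutes {1..2*m}. ?T (transpose (2*m+2) j \<circ> \<sigma>))"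
    by (rule sum_over_permutations_insert) auto
  also have "\<dots> = (\<Sum>\<sigma> | \<sigma> permutes {1..2*m}. ?T \<sigma>)
     + (\<Sum>j\<in>{1..2*m}. \<Sum>\<sigma> | \<sigma> permutes {1..2*m}. ?T (transpose (2*m+2) j \<circ> \<sigma>))"
    by (subst sum.insert) auto
  also have "(\<Sum>\<sigma> | \<sigma> permutes {1..2*m}. ?T \<sigma>)
     = b (2*m+1) (2*m+2) * (\<Sum>\<sigma> | \<sigma> permutes {1..2*m}. pf_term m b \<sigma>)"
    unfolding sum_distrib_left
  proof (intro sum.cong refl)
    fix \<sigma> assume "\<sigma> \<in> {\<sigma>. \<sigma> permutes {1..2*m}}"
    then have "\<sigma> (2*m+1) = 2*m+1" "\<sigma> (2*m+2) = 2*m+2"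
      by (auto intro: permutes_not_in)
    then show "?T \<sigma> = b (2*m+1) (2*m+2) * pf_term m b \<sigma>"
      by (simp add: pf_term_def)
  qed
  also have "(\<Sum>j\<in>{1..2*m}. \<Sum>\<sigma> | \<sigma> permutes {1..2*m}. ?T (transpose (2*m+2) j \<circ> \<sigma>))
     = (\<Sum>j\<in>{1..2*m}. - b (2*m+1) j * (\<Sum>\<sigma> | \<sigma> permutes {1..2*m}.
          pf_term m (\<lambda>i k. b (transpose j (2*m+2) i) (transpose j (2*m+2) k)) \<sigma>))"
    unfolding sum_distrib_left
  proof (intro sum.cong refl)
    fix \<sigma> j assume "\<sigma> \<in> {\<sigma>. \<sigma> permutes {1..2*m}}" and j: "j \<in> {1..2*m}"
    then have \<sigma>: "\<sigma> permutes {1..2*m}" by simp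
    then have fixed: "\<sigma> (2*m+1) = 2*m+1" "\<sigma> (2*m+2) = 2*m+2"
      by (auto intro: permutes_not_in)
    have "sign (transpose (2*m+2) j \<circ> \<sigma>) = - sign \<sigma>"
      using \<sigma> j by (subst sign_compose)
        (auto intro: permutes_imp_permutation permutation_swap_id simp: sign_swap_id)
    moreover have "transpose (2*m+2) j (2*m+1) = 2*m+1" "transpose (2*m+2) j (2*m+2) = j"
      using j by (auto simp: transpose_def)
    ultimately show "?T (transpose (2*m+2) j \<circ> \<sigma>) = - b (2*m+1) j *
        pf_term m (\<lambda>i k. b (transpose j (2*m+2) i) (transpose j (2*m+2) k)) \<sigma>"
      using fixed unfolding transpose_commute[of j] by (simp add: pf_term_def)
  qed
  finally have main: "(\<Sum>\<sigma> | \<sigma> permutes ?S. ?T \<sigma>) = of_nat (2 * ?M) *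
     (b (2*m+1) (2*m+2) * (\<Sum>\<sigma> | \<sigma> permutes {1..2*m}. pf_term m b \<sigma>)
     + (\<Sum>j\<in>{1..2*m}. - b (2*m+1) j * (\<Sum>\<sigma> | \<sigma> permutes {1..2*m}.
          pf_term m (\<lambda>i k. b (transpose j (2*m+2) i) (transpose j (2*m+2) k)) \<sigma>)))" .
  \<comment> \<open>The \<open>2 * ?M\<close> equal contributions turn the normalising constant for
    \<open>?M\<close> pairs into the one for \<open>m\<close> pairs.\<close>
  have norm: "(1 / (2 ^ ?M * fact ?M)) * (of_nat (2 * ?M) * x) = (1 / (2 ^ m * fact m)) * x" for x :: complex
  proof -
    have "(of_nat ?M :: complex) \<noteq> 0" by (simp del: of_nat_Suc)
    moreover have "(of_nat (2 * ?M) :: complex) = 2 * of_nat ?M"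
      by (simp only: of_nat_mult of_nat_numeral)
    ultimately show ?thesis by (simp add: divide_simps mult_ac del: of_nat_Suc mult_Suc_right)
  qed
  have "pfaffian (n+2) b = pfaffian (2 * ?M) b" by (simp add: n)
  also have "\<dots> = (1 / (2 ^ m * fact m)) * 
     (b (2*m+1) (2*m+2) * (\<Sum>\<sigma> | \<sigma> permutes {1..2*m}. pf_term m b \<sigma>)
     + (\<Sum>j\<in>{1..2*m}. - b (2*m+1) j * (\<Sum>\<sigma> | \<sigma> permutes {1..2*m}.
          pf_term m (\<lambda>i k. b (transpose j (2*m+2) i) (transpose j (2*m+2) k)) \<sigma>)))"
    unfolding pfaffian_pf_term main norm ..
  also have "\<dots> = b (n+1) (n+2) * pfaffian n b
     - (\<Sum>j\<in>{1..n}. b (n+1) j *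
          pfaffian n (\<lambda>i k. b (transpose j (n+2) i) (transpose j (n+2) k)))"
    unfolding n pfaffian_pf_term
    by (simp add: distrib_left sum_distrib_left sum_divide_distrib diff_divide_distrib sum_negf mult_ac)
  finally show ?thesis .
qed

section \<open>Pfaffians of lists of vectors\<close>

text \<open>Each product meets the index \<open>i\<close> in exactly one factor, together with a
  different index. So additivity off the diagonal suffices; diagonal entries, where a bilinear form
  is quadratic, never occur.\<close>

lemma pfaffian_add:
  assumes "even n" and i: "i \<in> {1..n}"
    and row: "\<And>j. j \<in> {1..n} \<Longrightarrow> j \<noteq> i \<Longrightarrow> b i j = c i j + d i j"
    and col: "\<And>j. j \<in> {1..n} \<Longrightarrow> j \<noteq> i \<Longrightarrow> b j i = c j i + d j i"
    and other:
      "\<And>j k. j \<in> {1..n} - {i} \<Longrightarrow> k \<in> {1..n} - {i} \<Longrightarrow> c j k = b j k"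
      "\<And>j k. j \<in> {1..n} - {i} \<Longrightarrow> k \<in> {1..n} - {i} \<Longrightarrow> d j k = b j k"
  shows "pfaffian n b = pfaffian n c + pfaffian n d"
proof -
  let ?w = "\<lambda>b \<sigma>. \<Prod>k<n div 2. b (\<sigma> (2*k+1)) (\<sigma> (2*k+2))"
  have "?w b \<sigma> = ?w c \<sigma> + ?w d \<sigma>" if \<sigma>: "\<sigma> permutes {1..n}" for \<sigma> :: "nat \<Rightarrow> nat"
  proof -
    define q where "q = inv \<sigma> i"
    have q: "q \<in> {1..n}" "\<sigma> q = i"
      using permutes_in_image[OF permutes_inv[OF \<sigma>]] i permutes_inverses(1)[OF \<sigma>] by (auto simp: q_def)
    have eq_i: "\<sigma> j = i \<longleftrightarrow> j = q" for j
      using permutes_inv_eq[OF \<sigma>, of i j] q_def by auto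
    define k where "k = (q - 1) div 2"
    have k: "k < n div 2" and qk: "q = 2*k+1 \<or> q = 2*k+2"
      using q \<open>even n\<close> unfolding k_def by (auto elim!: evenE)
    have rest: "(\<Prod>l\<in>{..<n div 2}-{k}. e (\<sigma> (2*l+1)) (\<sigma> (2*l+2)))
        = (\<Prod>l\<in>{..<n div 2}-{k}. b (\<sigma> (2*l+1)) (\<sigma> (2*l+2)))"
      if "\<And>j k. j \<in> {1..n} - {i} \<Longrightarrow> k \<in> {1..n} - {i} \<Longrightarrow> e j k = b j k" for e
    proof (intro prod.cong refl that)
      fix l assume l: "l \<in> {..<n div 2}-{k}"
      then have "2*l+1 \<in> {1..n}" "2*l+2 \<in> {1..n}" by auto
      then show "\<sigma> (2*l+1) \<in> {1..n} - {i}" "\<sigma> (2*l+2) \<in> {1..n} - {i}"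
        using l qk unfolding Diff_iff permutes_in_image[OF \<sigma>] by (auto simp: eq_i)
    qed
    have in_range: "\<sigma> (2*k+1) \<in> {1..n}" "\<sigma> (2*k+2) \<in> {1..n}"
      using k by (auto simp only: permutes_in_image[OF \<sigma>]) auto
    have "b (\<sigma> (2*k+1)) (\<sigma> (2*k+2))
        = c (\<sigma> (2*k+1)) (\<sigma> (2*k+2)) + d (\<sigma> (2*k+1)) (\<sigma> (2*k+2))"
      using qk
    proof
      assume "q = 2*k+1"
      then have "\<sigma> (2*k+1) = i" "\<sigma> (2*k+2) \<noteq> i" unfolding eq_i by auto
      then show ?thesis using row in_range by simp
    next
      assume "q = 2*k+2"
      then have "\<sigma> (2*k+2) = i" "\<sigma> (2*k+1) \<noteq> i" unfolding eq_i by auto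
      then show ?thesis using col in_range by simp
    qed
    then show ?thesis
      using k rest[OF other(1)] rest[OF other(2)]
      by (simp add: prod.remove[of "{..<n div 2}" k] distrib_right)
  qed
  then have "(\<Sum>\<sigma> | \<sigma> permutes {1..n}. of_int (sign \<sigma>) * ?w b \<sigma>)
     = (\<Sum>\<sigma> | \<sigma> permutes {1..n}. of_int (sign \<sigma>) * ?w c \<sigma> + of_int (sign \<sigma>) * ?w d \<sigma>)"
    by (intro sum.cong refl) (simp add: distrib_left)
  then show ?thesis
    unfolding pfaffian_def by (simp add: sum.distrib distrib_left add_divide_distrib)
qed

text \<open>The Pfaffian of a Gram matrix as a function of the list of vectors: swaps, replacements
  and removals become list operations without renumbering. List positions start at 0, matrix indices
  at 1.\<close>

definition pf_list :: "('v \<Rightarrow> 'v \<Rightarrow> complex) \<Rightarrow> 'v list \<Rightarrow> complex" where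
  "pf_list w xs = pfaffian (length xs) (\<lambda>i j. w (xs ! (i-1)) (xs ! (j-1)))"

lemma pf_list_Nil [simp]: "pf_list w [] = 1"
  by (simp add: pf_list_def pfaffian_def)

lemma pf_list_map: "pf_list w (map f xs) = pf_list (\<lambda>x y. w (f x) (f y)) xs"
  unfolding pf_list_def length_map by (rule pfaffian_cong) auto

lemma pf_list_swap:
  assumes "i < length xs" "j < length xs" "i \<noteq> j"
  shows "pf_list w (xs[i := xs ! j, j := xs ! i]) = - pf_list w xs"
proof -
  let ?t = "transpose (Suc i) (Suc j)"
  have "xs[i := xs ! j, j := xs ! i] ! (k - 1) = xs ! (?t k - 1)" if k: "k \<in> {1..length xs}" for k
  proof -
    obtain l where "k = Suc l" "l < length xs" using k by (cases k) auto
    then show ?thesis using assms by (simp add: transpose_def nth_list_update)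
  qed
  then have "pf_list w (xs[i := xs ! j, j := xs ! i])
      = pfaffian (length xs) (\<lambda>k l. w (xs ! (?t k - 1)) (xs ! (?t l - 1)))"
    unfolding pf_list_def length_list_update
    by (intro pfaffian_cong) (simp only:)
  also have "\<dots> = of_int (sign ?t) * pf_list w xs"
    unfolding pf_list_def
    by (rule pfaffian_permute[where b = "\<lambda>k l. w (xs ! (k - 1)) (xs ! (l - 1))"])
      (use assms in \<open>auto intro: permutes_swap_id\<close>)
  finally show ?thesis using assms by (simp add: sign_swap_id)
qed

lemma pf_list_swap_adjacent: "pf_list w (us @ x # y # vs) = - pf_list w (us @ y # x # vs)"
  using pf_list_swap[of "length us" "us @ y # x # vs" "Suc (length us)" w]
  by (simp add: nth_append list_update_append)

lemma pf_list_repeated: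
  assumes "i < length xs" "j < length xs" "i \<noteq> j" "xs ! i = xs ! j"
  shows "pf_list w xs = 0"
proof -
  have "xs[i := xs ! j, j := xs ! i] = xs"
    using assms by (metis list_update_id)
  then have "pf_list w xs = - pf_list w xs"
    using pf_list_swap[OF assms(1-3), of w] by simp
  then show ?thesis by (simp add: eq_neg_iff_add_eq_0)
qed

text \<open>Carrying a pair past one vector takes two adjacent swaps, so no sign arises.\<close>

lemma pf_list_move_pair: "pf_list w (us @ x # y # vs) = pf_list w (us @ vs @ [x, y])"
proof (induction vs arbitrary: us)
  case (Cons z vs)
  have "pf_list w (us @ x # y # z # vs) = - pf_list w (us @ x # z # y # vs)"
    using pf_list_swap_adjacent[of w "us @ [x]" y z vs] by simp
  also have "\<dots> = pf_list w ((us @ [z]) @ x # y # vs)"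
    using pf_list_swap_adjacent[of w us x z "y # vs"] by simp
  also have "\<dots> = pf_list w ((us @ [z]) @ vs @ [x, y])"
    by (rule Cons.IH)
  finally show ?case by simp
qed simp

lemma pf_list_expand:
  assumes "even (length zs)" and skew: "\<And>x y. w x y = - w y x"
  shows "pf_list w (zs @ [x, y]) = w x y * pf_list w zs
     - (\<Sum>j<length zs. w x (zs ! j) * pf_list w (zs[j := y]))"
proof -
  let ?n = "length zs" and ?xs = "zs @ [x, y]"
  let ?b = "\<lambda>i j. w (?xs ! (i-1)) (?xs ! (j-1))"
  have "pf_list w ?xs = pfaffian (?n + 2) ?b"
    by (simp add: pf_list_def)
  also have "\<dots> = ?b (?n+1) (?n+2) * pfaffian ?n ?b
     - (\<Sum>j\<in>{1..?n}. ?b (?n+1) j *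
          pfaffian ?n (\<lambda>i k. ?b (transpose j (?n+2) i) (transpose j (?n+2) k)))"
    by (rule pfaffian_expand[OF assms(1)]) (rule skew)
  also have "?b (?n+1) (?n+2) = w x y" by (simp add: nth_append)
  also have "pfaffian ?n ?b = pf_list w zs"
    unfolding pf_list_def by (rule pfaffian_cong) (auto simp: nth_append)
  also have "(\<Sum>j\<in>{1..?n}. ?b (?n+1) j *
          pfaffian ?n (\<lambda>i k. ?b (transpose j (?n+2) i) (transpose j (?n+2) k)))
      = (\<Sum>j\<in>{1..?n}. w x (zs ! (j-1)) * pf_list w (zs[j-1 := y]))"
  proof (intro sum.cong refl arg_cong2[where f = "(*)"])
    fix j assume j: "j \<in> {1..?n}"
    then show "?b (?n+1) j = w x (zs ! (j-1))" by (auto simp: nth_append)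
    have "?xs ! (transpose j (?n+2) i - 1) = zs[j-1 := y] ! (i - 1)" if "i \<in> {1..?n}" for i
      using that j by (auto simp: transpose_def nth_append nth_list_update)
    then show "pfaffian ?n (\<lambda>i k. ?b (transpose j (?n+2) i) (transpose j (?n+2) k))
        = pf_list w (zs[j-1 := y])"
      unfolding pf_list_def length_list_update by (intro pfaffian_cong) presburger
  qed
  also have "\<dots> = (\<Sum>j<?n. w x (zs ! j) * pf_list w (zs[j := y]))"
    by (rule sum.reindex_bij_witness[of _ Suc "\<lambda>j. j - 1"]) auto
  finally show ?thesis .
qed

section \<open>Alternating forms and the merging identity\<close>

locale alternating_form =
  fixes w :: "'v::comm_monoid_add \<Rightarrow> 'v \<Rightarrow> complex"
  assumes add_left: "w (x + y) z = w x z + w y z"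
    and skew: "w x y = - w y x"
begin

lemma add_right: "w z (x + y) = w z x + w z y"
  using add_left[of x y z] skew[of z] by simp

lemma zero_right: "w z 0 = 0"
  using add_right[of z 0 0] by simp

lemma self: "w x x = 0"
  using skew[of x x] by (simp add: eq_neg_iff_add_eq_0)

lemma sum_list_right: "w z (sum_list xs) = (\<Sum>i<length xs. w z (xs ! i))"
  unfolding sum_list_sum_nth atLeast0LessThan
  using sum_comp_morphism[where h = "w z" and g = "(!) xs" and A = "{..<length xs}", OF zero_right add_right]
  by (simp add: o_def)

lemma pf_list_add:
  assumes "even (length xs)" "i < length xs"
  shows "pf_list w (xs[i := x + y]) = pf_list w (xs[i := x]) + pf_list w (xs[i := y])"
  unfolding pf_list_def length_list_update
  by (rule pfaffian_add[where i = "Suc i"])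
    (use assms in \<open>auto simp: add_left add_right nth_list_update\<close>)

lemma pf_list_merge:
  assumes ev: "even (length zs)" and total: "w x (y + sum_list zs + \<rho>) = 0"
  shows "pf_list w (zs @ [y, x]) =
     (\<Sum>j<length zs. w x (zs ! j) * pf_list w (zs[j := zs ! j + y + x])) + w x \<rho> * pf_list w zs"
proof -
  let ?P = "pf_list w zs"
  let ?S = "\<lambda>f. \<Sum>j<length zs. w x (zs ! j) * f j"
  have wxy: "w x y = - (?S (\<lambda>_. 1) + w x \<rho>)"
    using total unfolding eq_neg_iff_add_eq_0 by (simp add: add_right sum_list_right add.assoc)
  have "pf_list w (zs @ [x, x]) = 0"
    by (rule pf_list_repeated[of "length zs" _ "Suc (length zs)"]) (auto simp: nth_append)
  then have xx: "?S (\<lambda>j. pf_list w (zs[j := x])) = 0"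
    using pf_list_expand[where w = w and x = x and y = x, OF ev skew] by (simp add: self)
  \<comment> \<open>Multilinearity at place \<open>j\<close> gives three Pfaffians: the unchanged
    one accounts for the substituted \<open>w x y\<close>, the one with \<open>y\<close> is a term
    of the expansion, and those with \<open>x\<close> sum to 0 by \<open>xx\<close>.\<close>
  have "?S (\<lambda>j. pf_list w (zs[j := zs ! j + y + x]))
      = ?S (\<lambda>j. ?P + pf_list w (zs[j := y]) + pf_list w (zs[j := x]))"
    using ev by (intro sum.cong refl) (simp add: pf_list_add)
  also have "\<dots> = ?S (\<lambda>_. 1) * ?P + ?S (\<lambda>j. pf_list w (zs[j := y]))"
    using xx by (simp add: distrib_left sum.distrib sum_distrib_right)
  finally have merged: "?S (\<lambda>j. pf_list w (zs[j := zs ! j + y + x]))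
      = ?S (\<lambda>_. 1) * ?P + ?S (\<lambda>j. pf_list w (zs[j := y]))" .
  have "pf_list w (zs @ [y, x]) = - (w x y * ?P - ?S (\<lambda>j. pf_list w (zs[j := y])))"
    using pf_list_expand[where w = w and x = x and y = y, OF ev skew]
      pf_list_swap_adjacent[of w zs y x "[]"] by simp
  then show ?thesis
    unfolding merged wxy by (simp add: algebra_simps)
qed

end

text \<open>A listing of matched vertices with partners side by side. The choice of the first vertex
  in each pair, recorded in \<open>ts\<close>, is the reference orientation against which signs are
  measured.\<close>

definition pairs :: "('a \<Rightarrow> 'a) \<Rightarrow> 'a list \<Rightarrow> 'a list" where
  "pairs p ts = concat (map (\<lambda>t. [t, p t]) ts)"

lemma pairs_simps [simp]:
  "pairs p [] = []" "pairs p (t # ts) = t # p t # pairs p ts"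
  "pairs p (ts @ ss) = pairs p ts @ pairs p ss"
  by (simp_all add: pairs_def)

lemma length_pairs [simp]: "length (pairs p ts) = 2 * length ts"
  by (induction ts) auto

lemma set_pairs: "set (pairs p ts) = set ts \<union> p ` set ts"
  by (induction ts) auto

lemma pf_list_pairs_last:
  assumes "t \<in> set ts"
  shows "pf_list w (map u (pairs p ts)) = pf_list w (map u (pairs p (remove1 t ts)) @ [u t, u (p t)])"
proof -
  obtain us vs where "ts = us @ t # vs" "t \<notin> set us"
    using split_list_first[OF assms] by blast
  then show ?thesis
    using pf_list_move_pair[of w "map u (pairs p us)" "u t" "u (p t)" "map u (pairs p vs)"]
    by (simp add: remove1_append)
qed

text \<open>In the expansion along the last pair every other term contains a zero entry. With
  entries 1 and -1 on the pairs, this reads off the sign of an ordering.\<close>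

lemma pf_list_pairs_diagonal:
  assumes skew: "\<And>x y. b x y = - b y x" and "\<And>x y. b x y \<noteq> 0 \<Longrightarrow> y = p x"
    and "distinct (pairs p ts)"
  shows "pf_list b (pairs p ts) = (\<Prod>t\<leftarrow>ts. b t (p t))"
  using assms(3)
proof (induction ts rule: rev_induct)
  case (snoc t ts)
  have "b t (pairs p ts ! j) = 0" if "j < length (pairs p ts)" for j
  proof (rule ccontr)
    assume "b t (pairs p ts ! j) \<noteq> 0"
    then have "p t \<in> set (pairs p ts)"
      using assms(2) nth_mem[OF that] by metis
    then show False using snoc.prems by simp
  qed
  then show ?case
    using snoc pf_list_expand[of "pairs p ts" b t "p t", OF _ skew] by simp
qed simp

section \<open>Growing forests branch by branch\<close>

definition attach :: "(nat \<Rightarrow> nat) \<Rightarrow> nat \<Rightarrow> nat \<Rightarrow> (nat \<times> nat) set \<Rightarrow> (nat \<times> nat) set" where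
  "attach p t y F = insert (t, p t) (insert (p t, y) F)"

text \<open>
  The state of the growing process: \<open>C\<close> consists of the roots and the finished branches,
  \<open>P\<close> of the vertices of the current branch before its tip \<open>t\<close>, and \<open>U\<close> of the vertices
  without an outgoing edge yet, \<open>t\<close> included; \<open>p\<close> maps each vertex to its partner in the
  perfect matching. For \<open>m = 0\<close> the tip is a junk value.
\<close>

primrec forests ::
  "(nat \<Rightarrow> nat) \<Rightarrow> nat \<Rightarrow> nat set \<Rightarrow> nat set \<Rightarrow> nat \<Rightarrow> nat set \<Rightarrow> (nat \<times> nat) set set" where
  "forests p 0 C P t U = {{}}"
| "forests p (Suc m) C P t U =
     (\<Union>y \<in> C \<union> (U - {t, p t}). attach p t y `
        (if y \<in> C then forests p m (C \<union> P \<union> {t, p t}) {} (Min (U - {t, p t})) (U - {t, p t})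
         else forests p m C (P \<union> {t, p t}) y (U - {t, p t})))"

definition valid_state ::
  "(nat \<Rightarrow> nat) \<Rightarrow> nat \<Rightarrow> nat set \<Rightarrow> nat set \<Rightarrow> nat \<Rightarrow> nat set \<Rightarrow> bool" where
  "valid_state p m C P t U \<longleftrightarrow>
     finite C \<and> finite P \<and> finite U \<and> C \<inter> P = {} \<and> C \<inter> U = {} \<and> P \<inter> U = {} \<and>
     (\<forall>x\<in>U. p x \<in> U \<and> p x \<noteq> x \<and> p (p x) = x) \<and> card U = 2 * m \<and> (m > 0 \<longrightarrow> t \<in> U)"

lemma valid_state_tip:
  assumes "valid_state p (Suc m) C P t U"
  shows "t \<in> U" "p t \<in> U" "p t \<noteq> t" "p (p t) = t" "t \<notin> C" "t \<notin> P" "p t \<notin> C" "p t \<notin> P"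
  using assms unfolding valid_state_def by auto

lemma valid_state_rest:
  assumes "valid_state p (Suc m) C P t U" "U' = U - {t, p t}"
  shows "finite U'" "card U' = 2 * m" "\<forall>x\<in>U'. p x \<in> U' \<and> p x \<noteq> x \<and> p (p x) = x"
proof -
  note t = valid_state_tip[OF assms(1)]
  show "finite U'" using assms unfolding valid_state_def by auto
  show "card U' = 2 * m"
    using assms t unfolding valid_state_def by (auto simp: card_Diff_subset)
  show "\<forall>x\<in>U'. p x \<in> U' \<and> p x \<noteq> x \<and> p (p x) = x"
    using assms t unfolding valid_state_def by (metis Diff_iff insert_iff singletonD)
qed

lemma valid_state_continue:
  assumes "valid_state p (Suc m) C P t U" "U' = U - {t, p t}" "y \<in> U'"
  shows "valid_state p m C (P \<union> {t, p t}) y U'"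
  using valid_state_rest[OF assms(1,2)] valid_state_tip[OF assms(1)] assms
  unfolding valid_state_def by auto

lemma valid_state_close:
  assumes "valid_state p (Suc m) C P t U" "U' = U - {t, p t}"
  shows "valid_state p m (C \<union> P \<union> {t, p t}) {} (Min U') U'"
proof -
  note U' = valid_state_rest[OF assms]
  have "Min U' \<in> U'" if "m > 0"
  proof (rule Min_in[OF U'(1)])
    show "U' \<noteq> {}" using U'(2) that by auto
  qed
  then show ?thesis
    using U' valid_state_tip[OF assms(1)] assms
    unfolding valid_state_def by auto
qed

lemma forests_Suc_cases:
  assumes "F \<in> forests p (Suc m) C P t U"
  obtains y F' where "y \<in> C \<union> (U - {t, p t})" "F = attach p t y F'"
    "F' \<in> (if y \<in> C then forests p m (C \<union> P \<union> {t, p t}) {} (Min (U - {t, p t})) (U - {t, p t})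
         else forests p m C (P \<union> {t, p t}) y (U - {t, p t}))"
  using assms unfolding forests.simps UN_iff image_iff by blast

lemma forests_edges:
  assumes "valid_state p m C P t U" "F \<in> forests p m C P t U"
  shows "F \<subseteq> U \<times> (C \<union> P \<union> U)"
  using assms
proof (induction m arbitrary: C P t U F)
  case (Suc m)
  define U' where "U' = U - {t, p t}"
  note t = valid_state_tip[OF Suc.prems(1)]
  from Suc.prems(2) obtain y F' where y: "y \<in> C \<union> U'" and F: "F = attach p t y F'"
    and F': "F' \<in> (if y \<in> C then forests p m (C \<union> P \<union> {t, p t}) {} (Min U') U'
         else forests p m C (P \<union> {t, p t}) y U')"
    unfolding U'_def by (rule forests_Suc_cases)
  have "F' \<subseteq> U' \<times> (C \<union> P \<union> {t, p t} \<union> U')"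
  proof (cases "y \<in> C")
    case True
    then show ?thesis
      using Suc.IH[OF valid_state_close[OF Suc.prems(1) U'_def]] F' by auto
  next
    case False
    then show ?thesis
      using Suc.IH[OF valid_state_continue[OF Suc.prems(1) U'_def]] F' y by auto
  qed
  then show ?case
    using t y unfolding F attach_def U'_def by auto
qed simp

lemma finite_forests:
  assumes "valid_state p m C P t U"
  shows "finite (forests p m C P t U)"
proof (rule finite_subset)
  show "forests p m C P t U \<subseteq> Pow (U \<times> (C \<union> P \<union> U))"
    using forests_edges[OF assms] by blast
  show "finite (Pow (U \<times> (C \<union> P \<union> U)))"
    using assms unfolding valid_state_def by simp
qed

text \<open>Each matching edge that \<open>F\<close> orients against \<open>ts\<close> costs a
  factor \<open>- 1\<close>, as swapping its two vectors does in the Pfaffian. Being a product over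
  edges, this sign can be followed through the recursion.\<close>

definition orient_sign :: "(nat \<Rightarrow> nat) \<Rightarrow> nat list \<Rightarrow> (nat \<times> nat) set \<Rightarrow> complex" where
  "orient_sign p ts F = (\<Prod>t\<leftarrow>ts. if (t, p t) \<in> F then 1 else - 1)"

section \<open>Expanding the Pfaffian over grown forests\<close>

locale skew_matrix =
  fixes a :: "nat \<Rightarrow> nat \<Rightarrow> complex"
  assumes skew: "a x y = - a y x"
begin

text \<open>Multisets are the free commutative monoid on the vertices and serve as vectors: merging
  is addition of multisets, and this is the bilinear extension of \<open>a\<close>.\<close>

definition form :: "nat multiset \<Rightarrow> nat multiset \<Rightarrow> complex" where
  "form M N = (\<Sum>x\<in>#M. \<Sum>y\<in>#N. a x y)"

sublocale form: alternating_form form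
proof
  fix M N K :: "nat multiset"
  show "form (M + N) K = form M K + form N K"
    by (simp add: form_def)
  have "form M N = (\<Sum>y\<in>#N. \<Sum>x\<in>#M. - a y x)"
    unfolding form_def by (subst sum_mset.swap) (simp add: skew[symmetric])
  moreover have "(\<Sum>x\<in>#M. - f x) = - (\<Sum>x\<in>#M. f x)" for f :: "nat \<Rightarrow> complex" and M
    by (induction M) auto
  ultimately show "form M N = - form N M"
    by (simp add: form_def)
qed

lemma form_single_mset_set: "form {#x#} (mset_set A) = (\<Sum>y\<in>A. a x y)"
  by (simp add: form_def sum_unfold_sum_mset)

definition weight :: "(nat \<Rightarrow> nat) \<Rightarrow> (nat \<times> nat) set \<Rightarrow> complex" where
  "weight p F = (\<Prod>e\<in>{e\<in>F. snd e \<noteq> p (fst e)}. a (fst e) (snd e))"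

text \<open>The edge from \<open>t\<close> to \<open>p t\<close> is a matching edge and has no
  factor; the edge from \<open>p t\<close> to \<open>y\<close> has one because \<open>y\<close>
  differs from the partner \<open>t\<close> of \<open>p t\<close>.\<close>

lemma weight_attach:
  assumes "finite F" "F \<subseteq> U' \<times> W" "t \<notin> U'" "p t \<notin> U'" "p (p t) = t" "y \<noteq> t"
  shows "weight p (attach p t y F) = a (p t) y * weight p F"
proof -
  have "{e \<in> attach p t y F. snd e \<noteq> p (fst e)} = insert (p t, y) {e \<in> F. snd e \<noteq> p (fst e)}"
    using assms by (auto simp: attach_def)
  moreover have "(p t, y) \<notin> {e \<in> F. snd e \<noteq> p (fst e)}"
    using assms by auto
  ultimately show ?thesis
    using assms(1) unfolding weight_def by simp
qed

text \<open>\<open>s\<close> is the end of the new matching edge that \<open>ts\<close> lists first.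
  The edge is oriented from \<open>t\<close> to \<open>p t\<close>, so it agrees with the reference
  exactly when \<open>s = t\<close>; no other pair is affected.\<close>

lemma orient_sign_attach:
  assumes "F \<subseteq> U' \<times> W" "t \<notin> U'" "p t \<notin> U'" "p (p t) = t" "p t \<noteq> t" "y \<noteq> t"
    and "distinct (pairs p ts)" "s \<in> set ts" "s = t \<or> s = p t"
  shows "orient_sign p ts (attach p t y F)
      = (if s = t then 1 else - 1) * orient_sign p (remove1 s ts) F"
proof -
  obtain us vs where ts: "ts = us @ s # vs" "s \<notin> set us"
    using split_list_first[OF \<open>s \<in> set ts\<close>] by blast
  have "x \<noteq> t \<and> x \<noteq> p t" if "x \<in> set us \<union> set vs" for x
    using assms(4,7,9) that unfolding ts by (auto simp: set_pairs)
  then have "orient_sign p xs (attach p t y F) = orient_sign p xs F" if "set xs \<subseteq> set us \<union> set vs" for xs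
    unfolding orient_sign_def using that
    by (intro arg_cong[where f = prod_list] map_cong) (auto simp: attach_def)
  moreover have "(s, p s) \<in> attach p t y F \<longleftrightarrow> s = t"
    using assms by (auto simp: attach_def)
  ultimately show ?thesis
    using ts by (simp add: orient_sign_def remove1_append)
qed

text \<open>\<open>y\<close> can be read off as the head of the edge leaving \<open>p t\<close>, and
  \<open>F\<close> consists of the edges leaving \<open>U'\<close>.\<close>

lemma inj_on_attach:
  assumes "\<And>y F. y \<in> A \<Longrightarrow> F \<in> B y \<Longrightarrow> F \<subseteq> U' \<times> W" "t \<notin> U'" "p t \<notin> U'" "p t \<noteq> t"
  shows "inj_on (\<lambda>(y, F). attach p t y F) (Sigma A B)"
proof (rule inj_onI, clarify)
  fix y F z G
  assume *: "y \<in> A" "F \<in> B y" "z \<in> A" "G \<in> B z" "attach p t y F = attach p t z G"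
  have sub: "F \<subseteq> U' \<times> W" "G \<subseteq> U' \<times> W" using * assms(1) by blast+
  have "(p t, y) \<in> attach p t z G" using *(5) by (auto simp: attach_def)
  then have "y = z" using sub assms by (auto simp: attach_def)
  moreover have "F = {e \<in> attach p t y F. fst e \<in> U'}" "G = {e \<in> attach p t z G. fst e \<in> U'}"
    using sub assms by (auto simp: attach_def)
  ultimately show "y = z \<and> F = G" using *(5) by auto
qed

text \<open>The vector at the tip is the sum of the current branch, while every other vertex of
  \<open>U\<close> still stands for itself. The union \<open>C \<union> P \<union> U\<close> does
  not change along the recursion, so one hypothesis on row sums supplies the condition
  \<open>total\<close> of \<open>pf_list_merge\<close> at every stage.\<close>

lemma pf_list_eq_sum_forests:
  assumes "valid_state p m C P t U" "distinct (pairs p ts)" "set (pairs p ts) = U"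
    and "\<And>x. x \<in> U \<Longrightarrow> (\<Sum>y\<in>C \<union> P \<union> U. a x y) = 0"
  shows "pf_list form (map ((\<lambda>x. {#x#})(t := mset_set (insert t P))) (pairs p ts))
     = (\<Sum>F\<in>forests p m C P t U. orient_sign p ts F * weight p F)"
  using assms
proof (induction m arbitrary: C P t U ts)
  case 0
  then have "set (pairs p ts) = {}" by (auto simp: valid_state_def)
  then have "ts = []" by (cases ts) auto
  then show ?case by (simp add: orient_sign_def weight_def)
next
  case (Suc m)
  define U' where "U' = U - {t, p t}"
  let ?u = "\<lambda>P t. (\<lambda>x. {#x#})(t := mset_set (insert t P))"
  let ?B = "\<lambda>y. if y \<in> C then forests p m (C \<union> P \<union> {t, p t}) {} (Min U') U'
         else forests p m C (P \<union> {t, p t}) y U'"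
  note st = Suc.prems(1)
  note t = valid_state_tip[OF st]
  note U' = valid_state_rest[OF st U'_def]
  have fin: "finite C" "finite P" "finite U" and disj: "C \<inter> P = {}" "C \<inter> U = {}" "P \<inter> U = {}"
    using st unfolding valid_state_def by auto
  have U: "U = insert t (insert (p t) U')" and tU': "t \<notin> U'" "p t \<notin> U'"
    using t by (auto simp: U'_def)
  have sub: "F \<subseteq> U' \<times> (C \<union> P \<union> U)" if "y \<in> C \<union> U'" "F \<in> ?B y" for y F
    using that forests_edges[OF valid_state_close[OF st U'_def], of F]
      forests_edges[OF valid_state_continue[OF st U'_def], of y F] U
    by (auto split: if_splits)
  obtain s where s: "s \<in> set ts" "s = t \<or> s = p t"
  proof -
    have "set ts \<subseteq> U" "t \<in> set ts \<union> p ` set ts"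
      using t(1) Suc.prems(3) by (auto simp: set_pairs)
    moreover have "p (p x) = x" if "x \<in> U" for x
      using st that by (auto simp: valid_state_def)
    ultimately show ?thesis using that by fastforce
  qed
  define ts' where "ts' = remove1 s ts"
  obtain us vs where ts: "ts = us @ s # vs" "s \<notin> set us"
    using split_list_first[OF s(1)] by blast
  have ts': "ts' = us @ vs" using ts by (simp add: ts'_def remove1_append)
  have dist': "distinct (pairs p ts')"
    using Suc.prems(2) unfolding ts ts' by auto
  have set': "set (pairs p ts') = U'"
  proof -
    have sp: "{s, p s} = {t, p t}" using s(2) t(4) by auto
    have "U = {s, p s} \<union> set (pairs p ts')" "{s, p s} \<inter> set (pairs p ts') = {}"
      using Suc.prems(2,3) unfolding ts ts' by auto
    then show ?thesis unfolding U'_def sp by auto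
  qed
  define zs where "zs = map (\<lambda>x. {#x#}) (pairs p ts')"
  let ?c = "if s = t then 1 else - 1 :: complex"
  have "pf_list form (map (?u P t) (pairs p ts))
      = pf_list form (map (?u P t) (pairs p ts') @ [?u P t s, ?u P t (p s)])"
    unfolding ts'_def by (rule pf_list_pairs_last[OF s(1)])
  also have "map (?u P t) (pairs p ts') = zs"
    unfolding zs_def using set' tU' by (intro map_cong) auto
  \<comment> \<open>If \<open>ts\<close> lists \<open>p t\<close> before \<open>t\<close>, one swap
    puts the tip first; \<open>orient_sign_attach\<close> accounts for the resulting sign
    \<open>?c\<close>.\<close>
  also have "pf_list form (zs @ [?u P t s, ?u P t (p s)])
      = ?c * pf_list form (zs @ [?u P t t, ?u P t (p t)])"
    using s(2) t(3,4) pf_list_swap_adjacent[of form zs "?u P t (p t)" "?u P t t" "[]"] by auto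
  also have "[?u P t t, ?u P t (p t)] = [mset_set (insert t P), {#p t#}]"
    using t by auto
  \<comment> \<open>Roots and finished branches together play the part of \<open>\<rho>\<close>: a
    path stops on reaching any of them.\<close>
  also have "pf_list form (zs @ \<dots>) =
     (\<Sum>j<length zs. form {#p t#} (zs ! j) * pf_list form (zs[j := zs ! j + mset_set (insert t P) + {#p t#}]))
     + form {#p t#} (mset_set C) * pf_list form zs"
  proof (rule form.pf_list_merge)
    have "sum_list zs = mset (pairs p ts')"
      unfolding zs_def by (induction "pairs p ts'") auto
    then have "sum_list zs = mset_set U'"
      using mset_set_set[OF dist'] set' by simp
    moreover have "mset_set (insert t P) + mset_set U' + mset_set C = mset_set (C \<union> P \<union> U - {p t})"
    proof -
      have "C \<union> P \<union> U - {p t} = (insert t P \<union> U') \<union> C"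
        using t tU' unfolding U by auto
      moreover have "mset_set ((insert t P \<union> U') \<union> C) = mset_set (insert t P \<union> U') + mset_set C"
        using fin U'(1) disj t unfolding U by (intro mset_set_Union) auto
      moreover have "mset_set (insert t P \<union> U') = mset_set (insert t P) + mset_set U'"
        using fin U'(1) disj tU' unfolding U by (intro mset_set_Union) auto
      ultimately show ?thesis by simp
    qed
    \<comment> \<open>The total omits \<open>p t\<close>, whose own entry vanishes by
      skewness.\<close>
    moreover have "(\<Sum>y\<in>C \<union> P \<union> U - {p t}. a (p t) y) = (\<Sum>y\<in>C \<union> P \<union> U. a (p t) y)"
      using fin t skew[of "p t" "p t"]
      by (intro sum.mono_neutral_left) (auto simp: eq_neg_iff_add_eq_0)
    ultimately show "form {#p t#} (mset_set (insert t P) + sum_list zs + mset_set C) = 0"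
      using Suc.prems(4)[OF t(2)] by (simp add: form_single_mset_set)
  qed (simp add: zs_def)
  also have "(\<Sum>j<length zs. form {#p t#} (zs ! j) * pf_list form (zs[j := zs ! j + mset_set (insert t P) + {#p t#}]))
     = (\<Sum>y\<in>U'. a (p t) y * (\<Sum>F\<in>?B y. orient_sign p ts' F * weight p F))"
  proof (rule sum.reindex_bij_betw[of "\<lambda>j. pairs p ts' ! j", THEN trans[rotated], symmetric, THEN sym])
    show "bij_betw ((!) (pairs p ts')) {..<length zs} U'"
      using dist' set' unfolding zs_def by (intro bij_betw_nth) auto
    show "(\<Sum>j<length zs. form {#p t#} (zs ! j) * pf_list form (zs[j := zs ! j + mset_set (insert t P) + {#p t#}]))
      = (\<Sum>j<length zs. a (p t) (pairs p ts' ! j) *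
           (\<Sum>F\<in>?B (pairs p ts' ! j). orient_sign p ts' F * weight p F))"
    proof (intro sum.cong refl arg_cong2[where f = "(*)"])
      fix j assume "j \<in> {..<length zs}"
      then have j: "j < length (pairs p ts')" by (simp add: zs_def)
      define y where "y = pairs p ts' ! j"
      have y: "y \<in> U'" using set' nth_mem[OF j] by (simp add: y_def)
      then have yC: "y \<notin> C" and yP: "y \<notin> P \<union> {t, p t}"
        using disj tU' unfolding U by auto
      show "form {#p t#} (zs ! j) = a (p t) (pairs p ts' ! j)"
        using j by (simp add: zs_def form_def)
      \<comment> \<open>Merging the branch and \<open>p t\<close> into the entry at \<open>y\<close>
        gives exactly the vectors of the state whose tip is \<open>y\<close>.\<close>
      have "zs[j := zs ! j + mset_set (insert t P) + {#p t#}] = map (?u (P \<union> {t, p t}) y) (pairs p ts')"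
      proof (rule nth_equalityI)
        fix i assume "i < length (zs[j := zs ! j + mset_set (insert t P) + {#p t#}])"
        then have i: "i < length (pairs p ts')" by (simp add: zs_def)
        have "mset_set (insert y (P \<union> {t, p t})) = {#y#} + mset_set (insert t P) + {#p t#}"
        proof -
          have "insert y (P \<union> {t, p t}) = insert (p t) (insert y (insert t P))" by auto
          then show ?thesis using fin yP t by simp
        qed
        then show "zs[j := zs ! j + mset_set (insert t P) + {#p t#}] ! i
            = map (?u (P \<union> {t, p t}) y) (pairs p ts') ! i"
          using i j nth_eq_iff_index_eq[OF dist' i j] by (simp add: zs_def y_def nth_list_update)
      qed (simp add: zs_def)
      also have "pf_list form \<dots> = (\<Sum>F\<in>forests p m C (P \<union> {t, p t}) y U'. orient_sign p ts' F * weight p F)"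
      proof (rule Suc.IH[OF valid_state_continue[OF st U'_def y] dist' set'])
        fix x assume "x \<in> U'"
        moreover have "C \<union> (P \<union> {t, p t}) \<union> U' = C \<union> P \<union> U" unfolding U by auto
        ultimately show "(\<Sum>y\<in>C \<union> (P \<union> {t, p t}) \<union> U'. a x y) = 0"
          using Suc.prems(4) U by simp
      qed
      finally show "pf_list form (zs[j := zs ! j + mset_set (insert t P) + {#p t#}])
         = (\<Sum>F\<in>?B (pairs p ts' ! j). orient_sign p ts' F * weight p F)"
        using yC by (simp add: y_def)
    qed
  qed
  also have "pf_list form zs = (\<Sum>F\<in>forests p m (C \<union> P \<union> {t, p t}) {} (Min U') U'. orient_sign p ts' F * weight p F)"
  proof -
    \<comment> \<open>With nothing before the tip all entries are single vertices, so the Pfaffian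
      does not see where the next branch starts; the minimum matters only for the comparison with
      trimming.\<close>
    have "zs = map (?u {} (Min U')) (pairs p ts')"
      by (auto simp: zs_def)
    also have "pf_list form \<dots> = (\<Sum>F\<in>forests p m (C \<union> P \<union> {t, p t}) {} (Min U') U'. orient_sign p ts' F * weight p F)"
    proof (rule Suc.IH[OF valid_state_close[OF st U'_def] dist' set'])
      fix x assume "x \<in> U'"
      moreover have "C \<union> P \<union> {t, p t} \<union> {} \<union> U' = C \<union> P \<union> U" unfolding U by auto
      ultimately show "(\<Sum>y\<in>C \<union> P \<union> {t, p t} \<union> {} \<union> U'. a x y) = 0"
        using Suc.prems(4) U by simp
    qed
    finally show ?thesis .
  qed
  also have "form {#p t#} (mset_set C) * \<dots> = (\<Sum>y\<in>C. a (p t) y * (\<Sum>F\<in>?B y. orient_sign p ts' F * weight p F))"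
    by (simp add: form_single_mset_set sum_distrib_right)
  also have "(\<Sum>y\<in>U'. a (p t) y * (\<Sum>F\<in>?B y. orient_sign p ts' F * weight p F)) + \<dots>
      = (\<Sum>y\<in>C \<union> U'. a (p t) y * (\<Sum>F\<in>?B y. orient_sign p ts' F * weight p F))"
    using fin U'(1) disj U by (subst sum.union_disjoint) (auto simp: add.commute)
  also have "?c * \<dots> = (\<Sum>y\<in>C \<union> U'. \<Sum>F\<in>?B y. ?c * (a (p t) y * (orient_sign p ts' F * weight p F)))"
    by (simp only: sum_distrib_left)
  also have "\<dots> = (\<Sum>(y, F)\<in>Sigma (C \<union> U') ?B. ?c * (a (p t) y * (orient_sign p ts' F * weight p F)))"
  proof (rule sum.Sigma)
    show "\<forall>y\<in>C \<union> U'. finite (?B y)"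
      using finite_forests[OF valid_state_close[OF st U'_def]]
        finite_forests[OF valid_state_continue[OF st U'_def]] by auto
  qed (use fin U' in auto)
  also have "\<dots> = (\<Sum>(y, F)\<in>Sigma (C \<union> U') ?B.
      orient_sign p ts (attach p t y F) * weight p (attach p t y F))"
  proof (intro sum.cong refl, clarify)
    fix y F assume y: "y \<in> C \<union> U'" and F: "F \<in> ?B y"
    show "?c * (a (p t) y * (orient_sign p ts' F * weight p F))
       = orient_sign p ts (attach p t y F) * weight p (attach p t y F)"
    proof -
      have F': "F \<subseteq> U' \<times> (C \<union> P \<union> U)" using sub y F by blast
      then have "finite F"
        using fin U'(1) by (auto intro: finite_subset)
      moreover have "y \<noteq> t" using y t tU' by auto
      ultimately show ?thesis
        unfolding ts'_def
        using weight_attach[OF _ F' tU' t(4)]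
          orient_sign_attach[OF F' tU' t(4,3) _ Suc.prems(2) s]
        by simp
    qed
  qed
  also have "\<dots> = (\<Sum>F\<in>(\<lambda>(y, F). attach p t y F) ` Sigma (C \<union> U') ?B. orient_sign p ts F * weight p F)"
  proof -
    have "inj_on (\<lambda>(y, F). attach p t y F) (Sigma (C \<union> U') ?B)"
      by (rule inj_on_attach[where W = "C \<union> P \<union> U"]) (use sub tU' t(3) in blast)+
    then show ?thesis
      by (subst sum.reindex) (auto intro!: sum.cong)
  qed
  also have "(\<lambda>(y, F). attach p t y F) ` Sigma (C \<union> U') ?B = forests p (Suc m) C P t U"
  proof -
    have "(\<lambda>(y, F). attach p t y F) ` Sigma A B = (\<Union>y\<in>A. attach p t y ` B y)" for A B
      by force
    then show ?thesis unfolding forests.simps U'_def[symmetric] .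
  qed
  finally show ?case .
qed

end

section \<open>Trimming undoes growing\<close>

lemma forests_out_unique:
  assumes "valid_state p m C P t U" "F \<in> forests p m C P t U" "x \<in> U"
  shows "\<exists>!y. (x, y) \<in> F"
  using assms
proof (induction m arbitrary: C P t U F)
  case 0
  then show ?case by (auto simp: valid_state_def)
next
  case (Suc m)
  define U' where "U' = U - {t, p t}"
  note t = valid_state_tip[OF Suc.prems(1)]
  note cl = valid_state_close[OF Suc.prems(1) U'_def]
  note co = valid_state_continue[OF Suc.prems(1) U'_def]
  from Suc.prems(2) obtain y F' where y: "y \<in> C \<union> U'" and F: "F = attach p t y F'"
    and F': "F' \<in> (if y \<in> C then forests p m (C \<union> P \<union> {t, p t}) {} (Min U') U'
         else forests p m C (P \<union> {t, p t}) y U')"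
    unfolding U'_def by (rule forests_Suc_cases)
  have sub: "F' \<subseteq> U' \<times> UNIV"
    using F' y forests_edges[OF cl] forests_edges[OF co, of y] by (auto split: if_splits)
  have IH: "\<exists>!z. (x, z) \<in> F'" if "x \<in> U'"
    using F' y Suc.IH[OF cl _ that] Suc.IH[OF co _ that, of y] by (auto split: if_splits)
  show ?case
  proof (cases "x \<in> U'")
    case True
    then show ?thesis using IH unfolding F attach_def U'_def by auto
  next
    case False
    then have "x = t \<or> x = p t" using Suc.prems(3) by (auto simp: U'_def)
    then show ?thesis using sub t unfolding F attach_def U'_def by auto
  qed
qed

lemma forests_pairs:
  assumes "valid_state p m C P t U" "F \<in> forests p m C P t U" "x \<in> U"
  shows "(x, p x) \<in> F \<or> (p x, x) \<in> F"
  using assms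
proof (induction m arbitrary: C P t U F)
  case 0
  then show ?case by (auto simp: valid_state_def)
next
  case (Suc m)
  define U' where "U' = U - {t, p t}"
  note t = valid_state_tip[OF Suc.prems(1)]
  note cl = valid_state_close[OF Suc.prems(1) U'_def]
  note co = valid_state_continue[OF Suc.prems(1) U'_def]
  from Suc.prems(2) obtain y F' where y: "y \<in> C \<union> U'" and F: "F = attach p t y F'"
    and F': "F' \<in> (if y \<in> C then forests p m (C \<union> P \<union> {t, p t}) {} (Min U') U'
         else forests p m C (P \<union> {t, p t}) y U')"
    unfolding U'_def by (rule forests_Suc_cases)
  show ?case
  proof (cases "x \<in> U'")
    case True
    then have "(x, p x) \<in> F' \<or> (p x, x) \<in> F'"
      using F' y Suc.IH[OF cl] Suc.IH[OF co, of y] by (auto split: if_splits)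
    then show ?thesis unfolding F attach_def by auto
  next
    case False
    then have "x = t \<or> x = p t" using Suc.prems(3) by (auto simp: U'_def)
    then show ?thesis using t unfolding F attach_def by auto
  qed
qed

lemma rtrancl_not_Domain: "(x, y) \<in> r\<^sup>* \<Longrightarrow> x \<notin> Domain r \<Longrightarrow> x = y"
  by (metis Not_Domain_rtrancl)

text \<open>Edges may enter \<open>P\<close>, but only from branches grown after the current one has been closed;
  hence the second claim, which is what rules out cycles.\<close>

lemma forests_acyclic:
  assumes "valid_state p m C P t U" "F \<in> forests p m C P t U"
  shows "acyclic F \<and> (m > 0 \<longrightarrow> (t, z) \<in> F\<^sup>* \<longrightarrow> z \<notin> P)"
  using assms
proof (induction m arbitrary: C P t U F z)
  case 0
  then show ?case by (simp add: acyclic_def)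
next
  case (Suc m)
  define U' where "U' = U - {t, p t}"
  note t = valid_state_tip[OF Suc.prems(1)]
  note cl = valid_state_close[OF Suc.prems(1) U'_def]
  note co = valid_state_continue[OF Suc.prems(1) U'_def]
  have disj: "C \<inter> U = {}" "C \<inter> P = {}" "P \<inter> U = {}" using Suc.prems(1) by (auto simp: valid_state_def)
  from Suc.prems(2) obtain y F' where y: "y \<in> C \<union> U'" and F: "F = attach p t y F'"
    and F': "F' \<in> (if y \<in> C then forests p m (C \<union> P \<union> {t, p t}) {} (Min U') U'
         else forests p m C (P \<union> {t, p t}) y U')"
    unfolding U'_def by (rule forests_Suc_cases)
  have sub: "F' \<subseteq> U' \<times> UNIV"
    using F' y forests_edges[OF cl] forests_edges[OF co, of y] by (auto split: if_splits)
  \<comment> \<open>No path of \<open>F'\<close> leads from \<open>y\<close> back to the current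
    branch: for \<open>y \<in> C\<close> there is no outgoing edge at all, otherwise
    \<open>{t, p t}\<close> has joined the forbidden set \<open>P\<close> of the induction
    hypothesis.\<close>
  have *: "acyclic F' \<and> ((y, z) \<in> F'\<^sup>* \<longrightarrow> z \<notin> P \<union> {t, p t})" for z
  proof (cases "y \<in> C")
    case True
    then have "y \<notin> Domain F'" using sub disj by (auto simp: U'_def)
    then have "(y, z) \<in> F'\<^sup>* \<Longrightarrow> z = y" by (metis rtrancl_not_Domain)
    then show ?thesis
      using Suc.IH[OF cl] F' True disj t by auto
  next
    case False
    then have yU: "y \<in> U'" using y by auto
    then have "m > 0" using co[OF yU] by (auto simp: valid_state_def)
    then show ?thesis
      using Suc.IH[OF co[OF yU]] F' False by auto
  qed
  let ?G = "insert (p t, y) F'"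
  have dom: "t \<notin> Domain F'" "p t \<notin> Domain F'" using sub by (auto simp: U'_def)
  then have tG: "t \<notin> Domain ?G" using t by auto
  have from_pt: "z = p t \<or> (y, z) \<in> F'\<^sup>*" if "(p t, z) \<in> ?G\<^sup>*" for z
    using that dom rtrancl_not_Domain[of "p t" z F'] unfolding rtrancl_insert by auto
  have "acyclic ?G"
    using * by (auto simp: acyclic_insert)
  moreover have "(p t, t) \<notin> ?G\<^sup>*"
    using from_pt[of t] * t by auto
  ultimately have "acyclic F"
    unfolding F attach_def acyclic_insert by simp
  moreover have "z \<notin> P" if "(t, z) \<in> F\<^sup>*"
  proof -
    have "z = t \<or> (p t, z) \<in> ?G\<^sup>*"
      using that rtrancl_not_Domain[OF _ tG] unfolding F attach_def rtrancl_insert[of t] by auto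
    then show ?thesis using from_pt[of z] * t by auto
  qed
  ultimately show ?case by simp
qed

section \<open>Forests as graphs of functions, built and trimmed branch by branch\<close>

definition graph_on :: "('a \<Rightarrow> 'a) \<Rightarrow> 'a set \<Rightarrow> ('a \<times> 'a) set" where
  "graph_on f S = (\<lambda>x. (x, f x)) ` S"

lemma in_graph_on [simp]: "(x, y) \<in> graph_on f S \<longleftrightarrow> x \<in> S \<and> y = f x"
  by (auto simp: graph_on_def)

lemma out_nb_graph_on: "x \<in> S \<Longrightarrow> out_nb (graph_on f S) x = f x"
  by (simp add: out_nb_def)

lemma trim_step_empty: "trim_step V R {} = {}"
  by (simp add: trim_step_def)

lemma condition_C_empty: "condition_C V R M {}"
proof -
  have "(trim_step V R ^^ i) {} = {}" for i
    by (induction i) (simp_all add: trim_step_empty)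
  then show ?thesis by (simp add: condition_C_def Let_def)
qed

lemma condition_C_trim_step:
  assumes "E \<noteq> {}"
  shows "condition_C V R M E \<longleftrightarrow>
    even (path_len R E (trim_leaf V E)) \<and> {trim_leaf V E, out_nb E (trim_leaf V E)} \<in> M
      \<and> condition_C V R M (trim_step V R E)"
proof -
  have all_Suc: "(\<forall>i. Q i) \<longleftrightarrow> Q 0 \<and> (\<forall>i. Q (Suc i))" for Q :: "nat \<Rightarrow> bool"
    by (metis not0_implies_Suc)
  show ?thesis
    unfolding condition_C_def
    by (subst all_Suc) (use assms in \<open>simp add: Let_def funpow_Suc_right del: funpow.simps(2)\<close>)
qed

locale rooted_function =
  fixes V R :: "nat set" and f :: "nat \<Rightarrow> nat"
  assumes finite_V: "finite V" and disjoint: "V \<inter> R = {}"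
    and maps: "\<And>x. x \<in> V \<Longrightarrow> f x \<in> V \<union> R"
    and acyc: "acyclic (graph_on f V)"
begin

abbreviation W :: "nat set \<Rightarrow> (nat \<times> nat) set" where
  "W S \<equiv> graph_on f S"

text \<open>The time at which the orbit of \<open>v\<close> first meets the roots or the part
  \<open>S\<close> already built; \<open>branch\<close> stops just before that point. It is
  identified below with the length of a trimmed path.\<close>

definition hit :: "nat set \<Rightarrow> nat \<Rightarrow> nat" where
  "hit S v = (LEAST j. (f ^^ j) v \<in> S \<union> R)"

definition branch :: "nat set \<Rightarrow> nat \<Rightarrow> nat set" where
  "branch S v = (\<lambda>j. (f ^^ j) v) ` {..<hit S v}"

lemma orbit_trancl:
  assumes "\<And>k. k < j \<Longrightarrow> (f ^^ k) v \<in> V" "i < j"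
  shows "((f ^^ i) v, (f ^^ j) v) \<in> (W V)\<^sup>+"
  using assms
proof (induction j)
  case (Suc j)
  have step: "((f ^^ j) v, (f ^^ Suc j) v) \<in> W V" using Suc.prems(1)[of j] by simp
  show ?case
  proof (cases "i = j")
    case True
    then show ?thesis using step by blast
  next
    case False
    then have "((f ^^ i) v, (f ^^ j) v) \<in> (W V)\<^sup>+" using Suc by auto
    then show ?thesis using step by (rule trancl_into_trancl)
  qed
qed simp

lemma orbit_neq:
  assumes "\<And>k. k < j \<Longrightarrow> (f ^^ k) v \<in> V" "i < j"
  shows "(f ^^ i) v \<noteq> (f ^^ j) v"
  using orbit_trancl[OF assms] acyc by (auto simp: acyclic_def)

text \<open>An orbit that never meets \<open>R\<close> stays in \<open>V\<close>, where acyclicity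
  makes it injective; as \<open>V\<close> is finite, this is absurd.\<close>

lemma hit_exists: "v \<in> V \<Longrightarrow> \<exists>j. (f ^^ j) v \<in> S \<union> R"
proof (rule ccontr)
  assume v: "v \<in> V" and "\<nexists>j. (f ^^ j) v \<in> S \<union> R"
  then have not_R: "(f ^^ j) v \<notin> R" for j
    by blast
  have in_V: "(f ^^ j) v \<in> V" for j
  proof (induction j)
    case (Suc j)
    then show ?case using maps[OF Suc.IH] not_R[of "Suc j"] by auto
  qed (simp add: v)
  have "inj (\<lambda>j. (f ^^ j) v)"
  proof (rule injI)
    fix i j assume "(f ^^ i) v = (f ^^ j) v"
    then show "i = j"
      using orbit_neq[of i v j, OF in_V] orbit_neq[of j v i, OF in_V] by (cases i j rule: linorder_cases) auto
  qed
  moreover have "finite (range (\<lambda>j. (f ^^ j) v))"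
    using in_V finite_V by (auto intro: finite_subset)
  ultimately show False
    using finite_imageD by blast
qed

context
  fixes S v
  assumes v: "v \<in> V - S"
begin

lemma hit_in: "(f ^^ hit S v) v \<in> S \<union> R"
  unfolding hit_def by (rule LeastI_ex) (use hit_exists v in blast)

lemma hit_positive: "hit S v > 0"
  using hit_in v disjoint by (cases "hit S v") auto

lemma before_hit: "j < hit S v \<Longrightarrow> (f ^^ j) v \<in> V - S"
proof (induction j)
  case 0
  then show ?case using v by simp
next
  case (Suc j)
  then have "(f ^^ Suc j) v \<notin> S \<union> R" using not_less_Least unfolding hit_def by blast
  moreover have "(f ^^ Suc j) v \<in> V \<union> R" using Suc maps by simp
  ultimately show ?case by blast
qed

lemma orbit_distinct:
  assumes "i < j" "j \<le> hit S v"
  shows "(f ^^ i) v \<noteq> (f ^^ j) v"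
  by (rule orbit_neq) (use assms before_hit in auto)

lemma branch_subset: "branch S v \<subseteq> V - S"
  using before_hit by (auto simp: branch_def)

lemma start_in_branch: "v \<in> branch S v"
  unfolding branch_def using hit_positive by (intro image_eqI[where x = 0]) auto

end

text \<open>The invariant of a union of branches, each started at the smallest vertex left. The last
  clause is decisive: all leaves lie below the vertices still to come, so the next starting vertex
  will be the largest leaf.\<close>

definition stage :: "nat set \<Rightarrow> bool" where
  "stage S \<longleftrightarrow> S \<subseteq> V \<and> f ` S \<subseteq> S \<union> R \<and> (\<forall>l\<in>leaves V (W S). \<forall>z\<in>V - S. l < z)"

lemma leaves_graph_on: "S \<subseteq> V \<Longrightarrow> leaves V (W S) = {x \<in> S. x \<notin> f ` S}"
  by (auto simp: leaves_def)

context
  fixes S v S'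
  assumes stage: "stage S" and ne: "V - S \<noteq> {}" and v_def: "v = Min (V - S)"
    and S'_def: "S' = S \<union> branch S v"
begin

lemma v_in: "v \<in> V - S"
  using Min_in[OF _ ne] finite_V unfolding v_def by simp

lemma v_least: "z \<in> V - S \<Longrightarrow> v \<le> z"
  using finite_V unfolding v_def by simp

text \<open>\<open>f\<close> maps \<open>S\<close> into \<open>S \<union> R\<close>, so nothing in
  \<open>S\<close> points into the new branch, and within the branch the orbit is injective. Hence
  \<open>v\<close> becomes a leaf and no vertex of the branch is a fork.\<close>

lemma preimage_orbit:
  assumes "j < hit S v" "x \<in> S'" "f x = (f ^^ j) v"
  shows "\<exists>i. j = Suc i \<and> x = (f ^^ i) v"
proof -
  have "x \<notin> S"
    using assms before_hit[OF v_in assms(1)] stage disjoint unfolding stage_def by fastforce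
  then obtain i where i: "i < hit S v" "x = (f ^^ i) v"
    using assms(2) unfolding S'_def branch_def by auto
  then have "(f ^^ Suc i) v = (f ^^ j) v" using assms(3) by simp
  then have "Suc i = j"
    using orbit_distinct[OF v_in, of "Suc i" j] orbit_distinct[OF v_in, of j "Suc i"] i assms(1)
    by (cases "Suc i" j rule: linorder_cases) auto
  then show ?thesis using i by blast
qed

lemma next_subset: "S' \<subseteq> V"
  using stage branch_subset[OF v_in] by (auto simp: S'_def stage_def)

lemma next_closed: "f ` S' \<subseteq> S' \<union> R"
proof -
  have "(f ^^ Suc j) v \<in> S' \<union> R" if "j < hit S v" for j
  proof (cases "Suc j = hit S v")
    case True
    then show ?thesis using hit_in[OF v_in] by (auto simp: S'_def)
  next
    case False
    then have "Suc j < hit S v" using that by simp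
    then show ?thesis unfolding S'_def branch_def by blast
  qed
  then show ?thesis
    using stage by (auto simp: S'_def branch_def stage_def)
qed

text \<open>Later vertices of the branch have a predecessor, so \<open>v\<close> is the only new
  leaf. The first claim is only an inclusion because the branch may end on an old leaf.\<close>

lemma next_leaves: "leaves V (W S') \<subseteq> insert v (leaves V (W S))" "v \<in> leaves V (W S')"
proof -
  have S: "S \<subseteq> V" using stage by (simp add: stage_def)
  show "v \<in> leaves V (W S')"
  proof -
    have "f x \<noteq> v" if "x \<in> S'" for x
      using preimage_orbit[of 0 x] that hit_positive[OF v_in] by auto
    then show ?thesis
      using start_in_branch[OF v_in] unfolding leaves_graph_on[OF next_subset] by (auto simp: S'_def)
  qed
  show "leaves V (W S') \<subseteq> insert v (leaves V (W S))"
  proof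
    fix x assume x: "x \<in> leaves V (W S')"
    have "x \<in> insert v S"
    proof (rule ccontr)
      assume "x \<notin> insert v S"
      moreover have "x \<in> S'" using x unfolding leaves_graph_on[OF next_subset] by simp
      ultimately obtain j where j: "j < hit S v" "x = (f ^^ j) v" "x \<noteq> v"
        unfolding S'_def branch_def by auto
      then obtain i where "j = Suc i" by (cases j) auto
      then have "x = f ((f ^^ i) v)" "(f ^^ i) v \<in> S'"
        using j by (auto simp: S'_def branch_def)
      then show False using x by (auto simp: leaves_graph_on[OF next_subset])
    qed
    then show "x \<in> insert v (leaves V (W S))"
      using x unfolding leaves_graph_on[OF next_subset] leaves_graph_on[OF S] by (auto simp: S'_def)
  qed
qed

lemma old_leaf_less: "l \<in> leaves V (W S) \<Longrightarrow> l < v"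
  using stage v_in by (auto simp: stage_def)

lemma next_stage: "stage S'"
proof -
  have "l < z" if "l \<in> leaves V (W S')" "z \<in> V - S'" for l z
  proof -
    have z: "z \<in> V - S" "z \<noteq> v" using that(2) start_in_branch[OF v_in] by (auto simp: S'_def)
    have "l \<le> v" using next_leaves(1) that(1) old_leaf_less by fastforce
    also have "v < z" using v_least[OF z(1)] z(2) by simp
    finally show ?thesis .
  qed
  then show ?thesis using next_subset next_closed by (auto simp: stage_def)
qed

lemma trim_leaf_next: "trim_leaf V (W S') = v"
  unfolding trim_leaf_def
proof (rule Max_eqI)
  show "finite (leaves V (W S'))" using finite_V by (simp add: leaves_def)
  show "y \<le> v" if "y \<in> leaves V (W S')" for y
    using next_leaves(1) that old_leaf_less by fastforce
qed (rule next_leaves(2))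

lemma orbit_in_next: "j < hit S v \<Longrightarrow> (f ^^ j) v \<in> S'"
  by (auto simp: S'_def branch_def)

lemma path_vtx_next: "j \<le> hit S v \<Longrightarrow> path_vtx (W S') v j = (f ^^ j) v"
proof (induction j)
  case (Suc j)
  then show ?case
    using out_nb_graph_on[OF orbit_in_next, of j f] by (simp add: path_vtx_def)
qed (simp add: path_vtx_def)

text \<open>Inside the branch no stopping rule applies: the vertex lies outside \<open>R\<close>,
  has at most one incoming edge, and is no smaller than the minimum \<open>v\<close>. At the end
  point one does: outside \<open>R\<close> it lies in \<open>S\<close> and is either entered from
  \<open>S\<close> as well, hence a fork, or an old leaf, hence smaller than
  \<open>v\<close>.\<close>

lemma stops_next:
  assumes "0 < j" "j \<le> hit S v"
  shows "stops R (W S') v ((f ^^ j) v) \<longleftrightarrow> j = hit S v"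
proof (cases "j = hit S v")
  case False
  then have j: "j < hit S v" using assms by simp
  let ?x = "(f ^^ j) v"
  have x: "?x \<in> V - S" using before_hit[OF v_in j] .
  have "{u. (u, ?x) \<in> W S'} \<subseteq> {(f ^^ (j - 1)) v}"
    using preimage_orbit[OF j] by fastforce
  then have "card {u. (u, ?x) \<in> W S'} \<le> 1"
    using card_mono[of "{(f ^^ (j - 1)) v}"] by fastforce
  then show ?thesis
    using False x disjoint v_least[OF x] by (auto simp: stops_def)
next
  case True
  let ?x = "(f ^^ j) v"
  let ?y = "(f ^^ (j - 1)) v"
  have y: "f ?y = ?x" using assms by (cases j) auto
  have y': "?y \<in> S'" "?y \<notin> S"
    using assms before_hit[OF v_in, of "j - 1"] orbit_in_next[of "j - 1"] by auto
  have "stops R (W S') v ?x" if S: "?x \<in> S"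
  proof (cases "?x \<in> f ` S")
    case True
    then obtain u where u: "u \<in> S" "f u = ?x" by auto
    have "finite {u. (u, ?x) \<in> W S'}"
      using finite_subset[OF next_subset finite_V] by (rule rev_finite_subset) auto
    moreover have "{u, ?y} \<subseteq> {u. (u, ?x) \<in> W S'}" "u \<noteq> ?y"
      using u y y' by (auto simp: S'_def)
    ultimately have "card {u, ?y} \<le> card {u. (u, ?x) \<in> W S'}"
      by (intro card_mono)
    then show ?thesis using \<open>u \<noteq> ?y\<close> by (simp add: stops_def)
  next
    case False
    then have "?x \<in> leaves V (W S)"
      using S stage by (auto simp: stage_def leaves_graph_on)
    then show ?thesis using old_leaf_less by (simp add: stops_def)
  qed
  then show ?thesis
    using hit_in[OF v_in] True by (auto simp: stops_def)
qed

lemma path_len_next: "path_len R (W S') v = hit S v"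
  unfolding path_len_def
proof (rule Least_equality)
  show "1 \<le> hit S v \<and> stops R (W S') v (path_vtx (W S') v (hit S v))"
    using hit_positive[OF v_in] stops_next[of "hit S v"] path_vtx_next[of "hit S v"] by auto
  show "hit S v \<le> k" if "1 \<le> k \<and> stops R (W S') v (path_vtx (W S') v k)" for k
    using that stops_next[of k] path_vtx_next[of k] by (cases "k \<le> hit S v") auto
qed

lemma trim_step_next: "trim_step V R (W S') = W S"
proof -
  have "(path_vtx (W S') v j, path_vtx (W S') v (Suc j)) = ((f ^^ j) v, f ((f ^^ j) v))"
    if "j < hit S v" for j
    using that path_vtx_next[of j] path_vtx_next[of "Suc j"] by simp
  then have "path_edges R (W S') v = {((f ^^ j) v, f ((f ^^ j) v)) | j. j < hit S v}"
    unfolding path_edges_def path_len_next by (intro Collect_cong ex_cong1) auto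
  also have "\<dots> = W (branch S v)"
    by (auto simp: branch_def graph_on_def)
  finally have "path_edges R (W S') v = W (branch S v)" .
  moreover have "W S' - W (branch S v) = W S"
    using branch_subset[OF v_in] by (auto simp: S'_def graph_on_def)
  ultimately show ?thesis
    unfolding trim_step_def trim_leaf_next by simp
qed

lemma condition_C_next:
  "condition_C V R M (W S') \<longleftrightarrow> even (hit S v) \<and> {v, f v} \<in> M \<and> condition_C V R M (W S)"
proof -
  have v: "v \<in> S'" using start_in_branch[OF v_in] by (simp add: S'_def)
  then have "W S' \<noteq> {}" by (auto simp: graph_on_def)
  then show ?thesis
    using condition_C_trim_step[of "W S'" V R M] out_nb_graph_on[OF v, of f]
    unfolding trim_leaf_next path_len_next trim_step_next by simp
qed

end

end

lemma ex_pairs: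
  assumes "finite A" "\<And>x. x \<in> A \<Longrightarrow> p x \<in> A \<and> p x \<noteq> x \<and> p (p x) = x"
  shows "\<exists>ts. distinct (pairs p ts) \<and> set (pairs p ts) = A"
  using assms
proof (induction A rule: finite_psubset_induct)
  case (psubset A)
  show ?case
  proof (cases "A = {}")
    case True
    then show ?thesis by (intro exI[of _ "[]"]) simp
  next
    case False
    then obtain x where x: "x \<in> A" by blast
    note px = psubset.prems[OF x]
    have rest: "p y \<in> A - {x, p x} \<and> p y \<noteq> y \<and> p (p y) = y" if "y \<in> A - {x, p x}" for y
    proof -
      have y: "p y \<in> A" "p y \<noteq> y" "p (p y) = y" using psubset.prems[of y] that by blast+
      moreover have "p y \<noteq> x" "p y \<noteq> p x" using that px y(3) by (metis DiffD2 insertCI)+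
      ultimately show ?thesis by blast
    qed
    have "A - {x, p x} \<subset> A" using x by blast
    then obtain ts where ts: "distinct (pairs p ts)" "set (pairs p ts) = A - {x, p x}"
      using psubset.IH[OF _ rest] by metis
    have "x \<noteq> p x" using px by metis
    then have "distinct (pairs p (x # ts))" using ts by simp
    moreover have "set (pairs p (x # ts)) = insert x (insert (p x) (A - {x, p x}))"
      by (simp only: pairs_simps list.simps ts(2))
    then have "set (pairs p (x # ts)) = A" using x conjunct1[OF px] by auto
    ultimately show ?thesis by blast
  qed
qed

section \<open>Condition (C) compared with the growing process\<close>

locale matched_rooted_function = rooted_function +
  fixes p :: "nat \<Rightarrow> nat"
  assumes finite_R: "finite R"
    and partner: "x \<in> V \<Longrightarrow> p x \<in> V \<and> p x \<noteq> x \<and> p (p x) = x"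
begin

definition remaining :: "nat set \<Rightarrow> bool" where
  "remaining S \<longleftrightarrow>
     W (V - S) \<in> forests p (card (V - S) div 2) (R \<union> S) {} (Min (V - S)) (V - S)"

definition matched_on :: "nat set \<Rightarrow> bool" where
  "matched_on S \<longleftrightarrow> (\<forall>x\<in>S. p x \<in> S \<and> (f x = p x \<or> f (p x) = x))"

lemma graph_on_attach:
  assumes "t \<in> U" "p t \<in> U" "p t \<noteq> t" "F \<subseteq> (U - {t, p t}) \<times> UNIV"
  shows "W U = attach p t y F \<longleftrightarrow> f t = p t \<and> f (p t) = y \<and> F = W (U - {t, p t})"
proof
  assume *: "W U = attach p t y F"
  have "(t, p t) \<in> W U" "(p t, y) \<in> W U" unfolding * attach_def by auto
  moreover have "F = {e \<in> attach p t y F. fst e \<in> U - {t, p t}}"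
    using assms(4) by (auto simp: attach_def)
  ultimately show "f t = p t \<and> f (p t) = y \<and> F = W (U - {t, p t})"
    unfolding *[symmetric] by auto
next
  assume "f t = p t \<and> f (p t) = y \<and> F = W (U - {t, p t})"
  then show "W U = attach p t y F"
    using assms(1,2) by (auto simp: attach_def)
qed

text \<open>The graph of a function leaves no choice: the edge leaving \<open>p t\<close> forces
  \<open>y = f (p t)\<close>, so the union over \<open>y\<close> collapses to one condition.\<close>

lemma graph_on_in_forests_Suc:
  assumes st: "valid_state p (Suc m) C P t U"
  shows "W U \<in> forests p (Suc m) C P t U \<longleftrightarrow>
    f t = p t \<and> f (p t) \<in> C \<union> (U - {t, p t}) \<and>
    W (U - {t, p t}) \<in>
      (if f (p t) \<in> C then forests p m (C \<union> P \<union> {t, p t}) {} (Min (U - {t, p t})) (U - {t, p t})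
       else forests p m C (P \<union> {t, p t}) (f (p t)) (U - {t, p t}))"
    (is "_ \<longleftrightarrow> _ \<and> _ \<and> _ \<in> ?B (f (p t))")
proof -
  let ?U = "U - {t, p t}"
  note t = valid_state_tip[OF st]
  have sub: "F \<subseteq> ?U \<times> UNIV" if "y \<in> C \<union> ?U" "F \<in> ?B y" for y F
    using that forests_edges[OF valid_state_close[OF st refl], of F]
      forests_edges[OF valid_state_continue[OF st refl], of y F]
    by (auto split: if_splits)
  have "W U \<in> forests p (Suc m) C P t U \<longleftrightarrow> (\<exists>y\<in>C \<union> ?U. \<exists>F\<in>?B y. W U = attach p t y F)"
    unfolding forests.simps UN_iff image_iff ..
  also have "\<dots> \<longleftrightarrow> (\<exists>y\<in>C \<union> ?U. \<exists>F\<in>?B y. f t = p t \<and> f (p t) = y \<and> F = W ?U)"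
    by (intro bex_cong refl graph_on_attach t sub)
  also have "\<dots> \<longleftrightarrow> f t = p t \<and> f (p t) \<in> C \<union> ?U \<and> W ?U \<in> ?B (f (p t))"
    by blast
  finally show ?thesis .
qed

text \<open>The state after \<open>i\<close> matching edges of the branch of \<open>v\<close>.
  Growing follows the orbit only while each even-numbered vertex is sent to its partner, and it
  closes the branch exactly when the orbit meets \<open>R \<union> S\<close>; so the hitting time
  must be even.\<close>

lemma graph_on_in_forests_branch:
  assumes v: "v \<in> V - S" and "S \<subseteq> V"
    and "2 * i < hit S v"
    and "U = V - S - (\<lambda>j. (f ^^ j) v) ` {..<2*i}"
    and "valid_state p m (R \<union> S) ((\<lambda>j. (f ^^ j) v) ` {..<2*i}) ((f ^^ (2*i)) v) U"
  shows "W U \<in> forests p m (R \<union> S) ((\<lambda>j. (f ^^ j) v) ` {..<2*i}) ((f ^^ (2*i)) v) U \<longleftrightarrow>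
    (\<forall>j\<ge>i. 2 * j < hit S v \<longrightarrow> (f ^^ Suc (2*j)) v = p ((f ^^ (2*j)) v)) \<and>
    even (hit S v) \<and> remaining (S \<union> branch S v)"
  using assms(3-)
proof (induction m arbitrary: i U)
  case 0
  have "(f ^^ (2*i)) v \<in> U"
    using before_hit[OF v 0(1)] orbit_distinct[OF v, of _ "2*i"] 0(1) unfolding 0(2) by fastforce
  then show ?case using 0(3) by (auto simp: valid_state_def)
next
  case (Suc m)
  let ?x = "\<lambda>j. (f ^^ j) v"
  let ?P = "\<lambda>i. ?x ` {..<2*i}" and ?L = "hit S v" and ?t = "?x (2*i)"
  note st = Suc.prems(3)
  note t = valid_state_tip[OF st]
  let ?U = "U - {?t, p ?t}"
  show ?case
  proof (cases "f ?t = p ?t")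
    case False
    then have "\<not> (\<forall>j\<ge>i. 2 * j < ?L \<longrightarrow> ?x (Suc (2*j)) = p (?x (2*j)))"
      using Suc.prems(1) by auto
    then show ?thesis
      unfolding graph_on_in_forests_Suc[OF st] using False by blast
  next
    case True
    have pt: "p ?t = ?x (Suc (2*i))" using True by simp
    \<comment> \<open>The partner of the tip is still in \<open>U\<close>, so the branch cannot end
      at an odd time.\<close>
    have "?x (Suc (2*i)) \<notin> S \<union> R"
      using t(2) disjoint unfolding pt Suc.prems(2) by blast
    then have L: "Suc (2*i) < ?L"
      using Suc.prems(1) hit_in[OF v] by (metis Suc_lessI)
    have fpt: "f (p ?t) = ?x (2 * Suc i)" by (simp add: pt)
    have P: "?P i \<union> {?t, p ?t} = ?P (Suc i)"
      unfolding pt by (auto simp: lessThan_Suc)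
    have U': "?U = V - S - ?P (Suc i)"
      unfolding Suc.prems(2) P[symmetric] by auto
    have alt: "(\<forall>j\<ge>i. 2 * j < ?L \<longrightarrow> ?x (Suc (2*j)) = p (?x (2*j)))
       \<longleftrightarrow> (\<forall>j\<ge>Suc i. 2 * j < ?L \<longrightarrow> ?x (Suc (2*j)) = p (?x (2*j)))"
      using pt by (metis Suc_leD le_antisym not_less_eq_eq)
    show ?thesis
    proof (cases "2 * Suc i = ?L")
      case True
      then have C: "f (p ?t) \<in> R \<union> S" using hit_in[OF v] unfolding fpt by auto
      have br: "?P (Suc i) = branch S v" unfolding True branch_def ..
      have U'': "?U = V - (S \<union> branch S v)" unfolding U' br by auto
      have "R \<union> S \<union> ?P i \<union> {?t, p ?t} = R \<union> (S \<union> branch S v)"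
        unfolding br[symmetric] P[symmetric] by auto
      moreover have "m = card ?U div 2"
        using valid_state_rest(2)[OF st refl] by simp
      ultimately have "W ?U \<in> forests p m (R \<union> S \<union> ?P i \<union> {?t, p ?t}) {} (Min ?U) ?U
          \<longleftrightarrow> remaining (S \<union> branch S v)"
        unfolding remaining_def U'' by simp
      moreover have "\<forall>j\<ge>Suc i. \<not> 2 * j < ?L" using True by auto
      moreover have "even ?L" unfolding True[symmetric] by simp
      ultimately show ?thesis
        unfolding graph_on_in_forests_Suc[OF st] alt using C \<open>f ?t = p ?t\<close> by simp
    next
      case False
      then have L': "2 * Suc i < ?L" using L by simp
      have x: "?x (2 * Suc i) \<in> V - S" using before_hit[OF v L'] .
      have "?x (2 * Suc i) \<notin> ?P (Suc i)"
        using orbit_distinct[OF v, of _ "2 * Suc i"] L' by fastforce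
      then have y: "f (p ?t) \<in> ?U" and C: "f (p ?t) \<notin> R \<union> S"
        using x disjoint unfolding fpt U' by auto
      have st': "valid_state p m (R \<union> S) (?P (Suc i)) (?x (2 * Suc i)) ?U"
        using valid_state_continue[OF st refl y] unfolding P fpt .
      show ?thesis
        unfolding graph_on_in_forests_Suc[OF st] alt
        using Suc.IH[OF L' U' st'] C y \<open>f ?t = p ?t\<close> unfolding P fpt by simp
    qed
  qed
qed

lemma remaining_next:
  assumes v: "v \<in> V - S" and least: "v = Min (V - S)" and S: "S \<subseteq> V" "\<And>x. x \<in> S \<Longrightarrow> p x \<in> S"
  shows "remaining S \<longleftrightarrow>
    (\<forall>j. 2 * j < hit S v \<longrightarrow> (f ^^ Suc (2*j)) v = p ((f ^^ (2*j)) v)) \<and>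
    even (hit S v) \<and> remaining (S \<union> branch S v)"
proof -
  have closed: "p x \<in> V - S" if "x \<in> V - S" for x
    using partner[of x] S(2)[of "p x"] that by auto
  obtain ts where "distinct (pairs p ts)" "set (pairs p ts) = V - S"
    using ex_pairs[of "V - S" p] finite_V closed partner by auto
  then have "even (card (V - S))"
    using distinct_card[of "pairs p ts"] by simp
  then have "valid_state p (card (V - S) div 2) (R \<union> S) {} v (V - S)"
    using v finite_V finite_R S(1) disjoint closed partner
    by (auto simp: valid_state_def finite_subset)
  then show ?thesis
    using graph_on_in_forests_branch[OF v S(1), of 0 "V - S"] hit_positive[OF v]
    unfolding remaining_def[of S] least[symmetric] by simp
qed

text \<open>The partner is the next vertex at even places and the previous one at odd places; an
  even hitting time keeps the successor of the last even place inside the branch.\<close>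

lemma alternating_branch:
  assumes v: "v \<in> V - S" and ev: "even (hit S v)"
    and alt: "\<And>j. 2 * j < hit S v \<Longrightarrow> (f ^^ Suc (2*j)) v = p ((f ^^ (2*j)) v)"
    and x: "x \<in> branch S v"
  shows "p x \<in> branch S v \<and> (f x = p x \<or> f (p x) = x)"
proof -
  obtain k where k: "k < hit S v" "x = (f ^^ k) v" using x by (auto simp: branch_def)
  show ?thesis
  proof (cases "even k")
    case True
    then obtain j where j: "k = 2 * j" by (elim evenE)
    have "Suc k < hit S v" using k(1) True ev by (metis Suc_lessI even_Suc)
    moreover have "p x = (f ^^ Suc k) v" using alt[of j] k j by simp
    ultimately show ?thesis using k(2) by (auto simp: branch_def intro!: image_eqI)
  next
    case False
    then obtain j where j: "k = Suc (2 * j)" by (auto elim: oddE)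
    have "(f ^^ (2*j)) v \<in> V" using before_hit[OF v, of "2*j"] k(1) j by auto
    then have "p x = (f ^^ (2*j)) v" using alt[of j] k j partner by simp
    moreover have "f ((f ^^ (2*j)) v) = x" using k j by simp
    ultimately show ?thesis using k(1) j by (auto simp: branch_def intro!: image_eqI)
  qed
qed

text \<open>The right-hand side keeps its truth value when \<open>S\<close> grows by a branch:
  \<open>condition_C\<close> sheds the branch added last, \<open>remaining\<close> the one to be
  grown next. At \<open>S = V\<close> it is Condition (C) with compatibility, at
  \<open>S = {}\<close> membership among the grown forests.\<close>

lemma condition_C_matched_iff:
  assumes "stage S"
  shows "condition_C V R ((\<lambda>x. {x, p x}) ` V) (W V) \<and> matched_on V \<longleftrightarrow>
    condition_C V R ((\<lambda>x. {x, p x}) ` V) (W S) \<and> matched_on S \<and> remaining S"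
  using assms
proof (induction "card (V - S)" arbitrary: S rule: less_induct)
  case less
  let ?M = "(\<lambda>x. {x, p x}) ` V"
  have S: "S \<subseteq> V" using less.prems by (simp add: stage_def)
  show ?case
  proof (cases "V - S = {}")
    case True
    then have "S = V" using S by blast
    then show ?thesis by (simp add: remaining_def graph_on_def)
  next
    case False
    define v where "v = Min (V - S)"
    define S' where "S' = S \<union> branch S v"
    note next_facts = less.prems False v_def S'_def
    have v: "v \<in> V - S" by (rule v_in[OF next_facts])
    let ?x = "\<lambda>j. (f ^^ j) v"
    let ?alt = "\<forall>j. 2 * j < hit S v \<longrightarrow> ?x (Suc (2*j)) = p (?x (2*j))"
    have "V - S' \<subset> V - S"
      using start_in_branch[OF v] v by (auto simp: S'_def)
    then have "card (V - S') < card (V - S)"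
      using finite_V by (intro psubset_card_mono) auto
    then have "condition_C V R ?M (W V) \<and> matched_on V \<longleftrightarrow>
        condition_C V R ?M (W S') \<and> matched_on S' \<and> remaining S'"
      using less.hyps next_stage[OF next_facts] by blast
    also have "\<dots> \<longleftrightarrow> even (hit S v) \<and> {v, f v} \<in> ?M \<and> condition_C V R ?M (W S)
        \<and> matched_on S' \<and> remaining S'"
      unfolding condition_C_next[OF next_facts] by blast
    also have "\<dots> \<longleftrightarrow> condition_C V R ?M (W S) \<and> matched_on S \<and>
        ?alt \<and> even (hit S v) \<and> remaining S'"
    proof -
      have "matched_on S \<and> ?alt"
        if ev: "even (hit S v)" and first: "{v, f v} \<in> ?M" and S': "matched_on S'"
      proof -
        have fv: "f v = p v" using first partner by (auto simp: doubleton_eq_iff)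
        \<comment> \<open>Condition (C) constrains only the first edge and the parity; alternation
          along the rest follows because all matching edges are present.\<close>
        have alt: "?x (Suc (2*j)) = p (?x (2*j))" if "2 * j < hit S v" for j
          using that
        proof (induction j)
          case 0
          then show ?case using fv by simp
        next
          case (Suc j)
          let ?y = "?x (2 * Suc j)"
          have y: "?y \<in> S'" "?y \<in> V"
            using orbit_in_next[OF next_facts Suc.prems] before_hit[OF v Suc.prems] by auto
          \<comment> \<open>A matching edge pointing into \<open>?y\<close> would come from the
            preceding orbit vertex, which is already matched with the one before it.\<close>
          have "f (p ?y) \<noteq> ?y"
          proof
            assume "f (p ?y) = ?y"
            then obtain i where "2 * Suc j = Suc i" "p ?y = ?x i"
              using preimage_orbit[OF next_facts Suc.prems, of "p ?y"] S' y by (auto simp: matched_on_def)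
            then have "p ?y = ?x (Suc (2*j))" by simp
            also have "\<dots> = p (?x (2*j))" using Suc by simp
            finally have "p (p ?y) = p (p (?x (2*j)))" by simp
            moreover have "?x (2*j) \<in> V" using before_hit[OF v, of "2*j"] Suc.prems by auto
            ultimately have "?y = ?x (2*j)" using partner y by metis
            then show False using orbit_distinct[OF v, of "2*j" "2 * Suc j"] Suc.prems by auto
          qed
          then have "f ?y = p ?y" using S' y by (auto simp: matched_on_def)
          then show ?case by simp
        qed
        \<comment> \<open>The branch is closed under \<open>p\<close>, so no partner of a vertex of
          \<open>S\<close> can lie in it.\<close>
        have "p x \<in> S" if "x \<in> S" for x
        proof -
          have "p x \<notin> branch S v"
          proof
            assume "p x \<in> branch S v"
            then have "p (p x) \<in> branch S v" using alternating_branch[OF v ev alt] by blast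
            moreover have "p (p x) = x" using partner[of x] that S by blast
            ultimately show False using that branch_subset[OF v] by auto
          qed
          then show ?thesis using S' that by (auto simp: matched_on_def S'_def)
        qed
        then have "matched_on S" using S' by (auto simp: matched_on_def S'_def)
        then show ?thesis using alt by blast
      qed
      moreover have "{v, f v} \<in> ?M \<and> matched_on S'"
        if ev: "even (hit S v)" and "matched_on S" and alt: ?alt
      proof -
        have "f v = p v" using alt[rule_format, of 0] hit_positive[OF v] by simp
        moreover have "matched_on S'"
          using \<open>matched_on S\<close> alternating_branch[OF v ev] alt by (auto simp: matched_on_def S'_def)
        ultimately show ?thesis using v by auto
      qed
      ultimately show ?thesis by blast
    qed
    also have "\<dots> \<longleftrightarrow> condition_C V R ?M (W S) \<and> matched_on S \<and> remaining S"
      using remaining_next[OF v v_def S] unfolding S'_def matched_on_def by blast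
    finally show ?thesis .
  qed
qed

lemma condition_C_iff_forests:
  "condition_C V R ((\<lambda>x. {x, p x}) ` V) (W V) \<and> matched_on V \<longleftrightarrow>
    W V \<in> forests p (card V div 2) R {} (Min V) V"
proof -
  have "stage {}" by (simp add: stage_def leaves_def graph_on_def)
  from condition_C_matched_iff[OF this] show ?thesis
    by (simp add: remaining_def matched_on_def graph_on_def condition_C_empty)
qed

end

section \<open>The Pfaffian as a sum over forests\<close>

lemma perfect_matching_partner:
  assumes "perfect_matching V (graph_edges V a) M"
    and skew: "\<And>i j. i \<in> V \<Longrightarrow> j \<in> V \<Longrightarrow> a i j = - a j i"
  shows "\<exists>p. (\<forall>x\<in>V. p x \<in> V \<and> p x \<noteq> x \<and> p (p x) = x \<and> a x (p x) \<noteq> 0) \<and>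
    M = (\<lambda>x. {x, p x}) ` V"
proof -
  have M: "M \<subseteq> graph_edges V a" and unique: "\<And>x. x \<in> V \<Longrightarrow> \<exists>!e. e \<in> M \<and> x \<in> e"
    using assms(1) by (auto simp: perfect_matching_def)
  have edge: "\<exists>i j. e = {i, j} \<and> i \<in> V \<and> j \<in> V \<and> i \<noteq> j \<and> a i j \<noteq> 0 \<and> a j i \<noteq> 0" if e: "e \<in> M" for e
  proof -
    have "e \<in> graph_edges V a" using M e by (rule subsetD)
    then obtain i j where ij: "e = {i, j}" "i \<in> V" "j \<in> V" "i \<noteq> j" "a i j \<noteq> 0"
      unfolding graph_edges_def by (elim CollectE exE conjE)
    moreover have "a j i \<noteq> 0" using skew[OF ij(2,3)] ij(5) by (metis neg_0_equal_iff_equal)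
    ultimately show ?thesis by blast
  qed
  have "\<forall>x\<in>V. \<exists>y. y \<in> V \<and> y \<noteq> x \<and> {x, y} \<in> M \<and> a x y \<noteq> 0"
  proof
    fix x assume "x \<in> V"
    then obtain e where e: "e \<in> M" "x \<in> e" using unique by blast
    then show "\<exists>y. y \<in> V \<and> y \<noteq> x \<and> {x, y} \<in> M \<and> a x y \<noteq> 0"
      using edge[OF e(1)] by (auto simp: insert_commute)
  qed
  then obtain p where p: "\<And>x. x \<in> V \<Longrightarrow> p x \<in> V \<and> p x \<noteq> x \<and> {x, p x} \<in> M \<and> a x (p x) \<noteq> 0"
    by metis
  have eqI: "e = {x, p x}" if "e \<in> M" "x \<in> e" "x \<in> V" for e x
    using unique[of x] p[of x] that by auto
  have inv: "p (p x) = x" if "x \<in> V" for x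
  proof -
    have "{x, p x} = {p x, p (p x)}"
      by (rule eqI) (use p[OF that] in auto)
    then show ?thesis using p[OF that] by (auto simp: doubleton_eq_iff)
  qed
  have "e \<in> (\<lambda>x. {x, p x}) ` V" if "e \<in> M" for e
    using edge[OF that] eqI[OF that] by auto
  then have "M = (\<lambda>x. {x, p x}) ` V" using p by auto
  then show ?thesis using p inv by blast
qed

lemma pf_list_permutation:
  assumes "distinct xs" "set xs = {1..n}"
    and \<tau>: "\<tau> = (\<lambda>k. if 1 \<le> k \<and> k \<le> length xs then xs ! (k - 1) else k)"
  shows "pf_list w xs = of_int (sign \<tau>) * pfaffian n w"
proof -
  have len: "length xs = n" using distinct_card[OF assms(1)] assms(2) by simp
  have "\<tau> permutes {1..n}"
  proof (rule inj_imp_permutes)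
    show "inj_on \<tau> {1..n}"
      using assms(1) unfolding inj_on_def \<tau> len by (auto simp: nth_eq_iff_index_eq len)
    show "\<tau> x \<in> {1..n}" if "x \<in> {1..n}" for x
      using that nth_mem[of "x - 1" xs] assms(2) unfolding \<tau> len by auto
    show "\<tau> i = i" if "i \<notin> {1..n}" for i
      using that unfolding \<tau> len by auto
  qed simp
  from pfaffian_permute[OF this, of w]
  have "pfaffian n (\<lambda>i j. w (\<tau> i) (\<tau> j)) = of_int (sign \<tau>) * pfaffian n w" .
  moreover have "pf_list w xs = pfaffian n (\<lambda>i j. w (\<tau> i) (\<tau> j))"
    unfolding pf_list_def len by (rule pfaffian_cong) (simp add: \<tau> len)
  ultimately show ?thesis by simp
qed

locale matched_vertices =
  fixes V R :: "nat set" and p :: "nat \<Rightarrow> nat"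
  assumes finite_VR: "finite V" "finite R" and disjoint: "V \<inter> R = {}"
    and partner: "\<And>x. x \<in> V \<Longrightarrow> p x \<in> V \<and> p x \<noteq> x \<and> p (p x) = x"
begin

abbreviation M :: "nat set set" where
  "M \<equiv> (\<lambda>x. {x, p x}) ` V"

abbreviation all_forests :: "(nat \<times> nat) set set" where
  "all_forests \<equiv> forests p (card V div 2) R {} (Min V) V"

lemma doubleton_in_M: "u \<in> V \<Longrightarrow> {u, v} \<in> M \<longleftrightarrow> v = p u"
  using partner by (auto simp: doubleton_eq_iff)

lemma initial_state: "valid_state p (card V div 2) R {} (Min V) V"
proof -
  obtain ts where "distinct (pairs p ts)" "set (pairs p ts) = V"
    using ex_pairs[OF finite_VR(1) partner] by blast
  then have "even (card V)"
    using distinct_card[of "pairs p ts"] by simp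
  moreover have "Min V \<in> V" if "card V div 2 > 0"
    using finite_VR that by (intro Min_in) auto
  ultimately show ?thesis
    using finite_VR disjoint partner by (auto simp: valid_state_def)
qed

lemma in_all_forests_iff:
  "F \<in> all_forests \<longleftrightarrow>
    F \<subseteq> V \<times> (V \<union> R) \<and> acyclic F \<and> (\<forall>x\<in>V. \<exists>!y. (x, y) \<in> F) \<and>
    compatible M F \<and> condition_C V R M F" (is "_ \<longleftrightarrow> ?Q")
proof -
  have key: "F \<in> all_forests \<longleftrightarrow> compatible M F \<and> condition_C V R M F"
    if F: "F \<subseteq> V \<times> (V \<union> R)" "acyclic F" "\<forall>x\<in>V. \<exists>!y. (x, y) \<in> F"
  proof -
    have out: "(x, y) \<in> F \<longleftrightarrow> x \<in> V \<and> y = out_nb F x" for x y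
      using F(1,3) the1_equality[of "\<lambda>y. (x, y) \<in> F" y] theI'[of "\<lambda>y. (x, y) \<in> F"]
      unfolding out_nb_def by blast
    have graph: "F = graph_on (out_nb F) V"
      using out by auto
    interpret matched_rooted_function V R "out_nb F" p
    proof
      show "out_nb F x \<in> V \<union> R" if "x \<in> V" for x
        using out[of x "out_nb F x"] F(1) that by blast
      show "acyclic (graph_on (out_nb F) V)" using F(2) graph by simp
    qed (use finite_VR disjoint partner in auto)
    have "compatible M F \<longleftrightarrow> (\<forall>x\<in>V. (x, p x) \<in> F \<or> (p x, x) \<in> F)"
      unfolding compatible_def by (auto simp: doubleton_eq_iff) blast+
    also have "\<dots> \<longleftrightarrow> matched_on V"
      unfolding matched_on_def using partner out by metis
    finally show ?thesis
      using condition_C_iff_forests graph by auto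
  qed
  show ?thesis
  proof
    assume *: "F \<in> all_forests"
    have "F \<subseteq> V \<times> (V \<union> R)" using forests_edges[OF initial_state *] by auto
    moreover have "acyclic F" using forests_acyclic[OF initial_state *] by blast
    moreover have "\<forall>x\<in>V. \<exists>!y. (x, y) \<in> F" using forests_out_unique[OF initial_state *] by blast
    ultimately show ?Q using key * by blast
  qed (use key in blast)
qed

lemma sign_matching_perm:
  assumes F: "F \<in> all_forests" and V: "V = {1..n}"
    and ts: "distinct (pairs p ts)" "set (pairs p ts) = V"
    and \<tau>: "\<tau> = (\<lambda>k. if 1 \<le> k \<and> k \<le> length (pairs p ts) then pairs p ts ! (k - 1) else k)"
  shows "of_int (sign \<tau>) * orient_sign p ts F = of_int (sign (matching_perm M F))"
proof -
  \<comment> \<open>At least one orientation occurs because the forest contains the matching, at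
    most one because it is acyclic.\<close>
  have one: "(x, p x) \<in> F \<longleftrightarrow> (p x, x) \<notin> F" if "x \<in> V" for x
  proof -
    have "acyclic F" using F unfolding in_all_forests_iff by (elim conjE)
    then have "\<not> ((x, p x) \<in> F \<and> (p x, x) \<in> F)"
      by (meson acyclic_def r_into_trancl trancl_trans)
    then show ?thesis using forests_pairs[OF initial_state F that] by blast
  qed
  \<comment> \<open>Both signs are read off the Pfaffian of one form, chosen so that the orientation in \<open>F\<close>
    of the matching gives value 1.\<close>
  define w :: "nat \<Rightarrow> nat \<Rightarrow> complex" where
    "w x y = (if x \<in> V \<and> y = p x then if (x, y) \<in> F then 1 else - 1 else 0)" for x y
  have skew: "w x y = - w y x" for x y
    using one[of x] one[of y] partner[of x] partner[of y] unfolding w_def by auto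
  have supp: "y = p x" if "w x y \<noteq> 0" for x y
    using that by (simp add: w_def split: if_splits)
  have sub: "F \<subseteq> V \<times> (V \<union> R)" using F unfolding in_all_forests_iff by (elim conjE)
  define ps where "ps = sorted_list_of_set {(u, v). (u, v) \<in> F \<and> {u, v} \<in> M}"
  define us where "us = map fst ps"
  have Fe: "{(u, v). (u, v) \<in> F \<and> {u, v} \<in> M} = {(u, v). (u, v) \<in> F \<and> v = p u}"
    using sub doubleton_in_M by auto
  have "finite F" using sub finite_VR by (auto intro: finite_subset)
  then have fin: "finite {(u, v). (u, v) \<in> F \<and> v = p u}"
    by (rule rev_finite_subset) auto
  have ps: "set ps = {(u, v). (u, v) \<in> F \<and> v = p u}" "distinct ps"
    using fin unfolding ps_def Fe by auto
  have set_us: "set us = {u \<in> V. (u, p u) \<in> F}"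
    using sub unfolding us_def set_map ps by force
  have dist_us: "distinct us"
    unfolding us_def distinct_map using ps by (auto simp: inj_on_def)
  have concat_eq: "concat (map (\<lambda>(u, v). [u, v]) ps) = pairs p us"
    unfolding pairs_def us_def using ps(1) by (auto intro!: arg_cong[where f = concat])
  have set_eq: "set (pairs p us) = V"
  proof
    show "set (pairs p us) \<subseteq> V" using partner by (auto simp: set_pairs set_us)
    show "V \<subseteq> set (pairs p us)"
    proof
      fix x assume x: "x \<in> V"
      then have "x \<in> set us \<or> p x \<in> set us" "p (p x) = x"
        using one[OF x] partner[OF x] by (auto simp: set_us)
      then show "x \<in> set (pairs p us)" unfolding set_pairs by force
    qed
  qed
  have dist: "distinct (pairs p us)"
  proof -
    have "card V = 2 * length us"
    proof -
      have "inj_on p (set us)" using partner unfolding inj_on_def set_us by (metis mem_Collect_eq)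
      moreover have "set us \<inter> p ` set us = {}"
        using one partner by (auto simp: set_us)
      ultimately have "card (set us \<union> p ` set us) = 2 * card (set us)"
        by (subst card_Un_disjoint) (auto simp: card_image)
      then show ?thesis using set_eq dist_us by (simp add: set_pairs distinct_card)
    qed
    then show ?thesis
      using set_eq by (intro card_distinct) simp
  qed
  have mp: "matching_perm M F =
      (\<lambda>k. if 1 \<le> k \<and> k \<le> length (pairs p us) then pairs p us ! (k - 1) else k)"
    unfolding matching_perm_def ps_def[symmetric] Let_def concat_eq ..
  have "of_int (sign (matching_perm M F)) * pfaffian n w = pf_list w (pairs p us)"
    by (rule pf_list_permutation[OF dist _ mp, symmetric]) (use set_eq V in metis)
  also have "\<dots> = (\<Prod>t\<leftarrow>us. w t (p t))"
    by (rule pf_list_pairs_diagonal[OF skew supp dist])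
  also have "map (\<lambda>t. w t (p t)) us = map (\<lambda>t. 1) us"
    by (rule map_cong) (auto simp: w_def set_us)
  also have "prod_list \<dots> = 1"
    by (induction us) auto
  finally have 1: "of_int (sign (matching_perm M F)) * pfaffian n w = 1" .
  have "of_int (sign \<tau>) * pfaffian n w = pf_list w (pairs p ts)"
    by (rule pf_list_permutation[OF ts(1) _ \<tau>, symmetric]) (use ts(2) V in metis)
  also have "\<dots> = (\<Prod>t\<leftarrow>ts. w t (p t))"
    by (rule pf_list_pairs_diagonal[OF skew supp ts(1)])
  also have "\<dots> = orient_sign p ts F"
    unfolding orient_sign_def using ts(2)
    by (intro arg_cong[where f = prod_list] map_cong) (auto simp: w_def set_pairs)
  finally have 2: "orient_sign p ts F = of_int (sign \<tau>) * pfaffian n w" ..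
  have sq: "of_int (sign \<pi>) * (of_int (sign \<pi>) * z) = (z :: complex)" for \<pi> :: "nat \<Rightarrow> nat" and z
    by (simp flip: mult.assoc of_int_mult)
  have "of_int (sign \<tau>) * orient_sign p ts F = pfaffian n w"
    unfolding 2 by (rule sq)
  also have "\<dots> = of_int (sign (matching_perm M F))"
    using sq[of "matching_perm M F" "pfaffian n w"] 1 by simp
  finally show ?thesis .
qed

end

theorem theorem1:
  fixes n r :: nat and a :: "nat \<Rightarrow> nat \<Rightarrow> complex" and M0 :: "nat set set"
  assumes "even n" and "n \<ge> 2" and "r \<ge> 1"
    and "\<forall>i\<in>{1..n+r}. \<forall>j\<in>{1..n+r}. a i j = - a j i"
    and "\<forall>i\<in>{1..n+r}. (\<Sum>j\<in>{1..n+r}. a i j) = 0"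
    and "perfect_matching {1..n} (graph_edges {1..n} a) M0"
  shows "pfaffian n a =
    (\<Sum>F | spanning_forest {1..n} {n+1..n+r} a F \<and> compatible M0 F
           \<and> condition_C {1..n} {n+1..n+r} M0 F.
       of_int (sign (matching_perm M0 F)) * (\<Prod>e\<in>F_minus M0 F. a (fst e) (snd e)))"
proof -
  let ?V = "{1..n}" and ?R = "{n+1..n+r}"
  have skew: "a i j = - a j i" if "i \<in> {1..n+r}" "j \<in> {1..n+r}" for i j
    using assms(4) that by blast
  have skew_V: "a i j = - a j i" if "i \<in> ?V" "j \<in> ?V" for i j
    by (rule skew) (use that in auto)
  have "\<exists>p. (\<forall>x\<in>?V. p x \<in> ?V \<and> p x \<noteq> x \<and> p (p x) = x \<and> a x (p x) \<noteq> 0) \<and>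
      M0 = (\<lambda>x. {x, p x}) ` ?V"
    by (rule perfect_matching_partner[OF assms(6) skew_V])
  then obtain p where p: "\<forall>x\<in>?V. p x \<in> ?V \<and> p x \<noteq> x \<and> p (p x) = x \<and> a x (p x) \<noteq> 0"
    and M0: "M0 = (\<lambda>x. {x, p x}) ` ?V"
    by (elim exE conjE) (rule that)
  interpret matched_vertices ?V ?R p
    by standard (use p in auto)
  \<comment> \<open>Extension by zero makes skewness hold for all pairs of naturals, as
    \<open>skew_matrix\<close> demands.\<close>
  define b where "b i j = (if i \<in> {1..n+r} \<and> j \<in> {1..n+r} then a i j else 0)" for i j
  interpret skew_matrix b
  proof
    show "b x y = - b y x" for x y
      using skew[of x y] by (auto simp: b_def)
  qed
  obtain ts where ts: "distinct (pairs p ts)" "set (pairs p ts) = ?V"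
    using ex_pairs[OF finite_VR(1) partner] by blast
  define \<tau> where "\<tau> = (\<lambda>k. if 1 \<le> k \<and> k \<le> length (pairs p ts) then pairs p ts ! (k - 1) else k)"
  have edges: "F \<subseteq> ?V \<times> (?V \<union> ?R)" if "F \<in> all_forests" for F
    using that unfolding in_all_forests_iff by (elim conjE)
  have F_minus_eq: "F_minus M0 F = {e \<in> F. snd e \<noteq> p (fst e)}" if "F \<in> all_forests" for F
  proof -
    have "{u, v} \<in> M0 \<longleftrightarrow> v = p u" if "(u, v) \<in> F" for u v
      unfolding M0 using edges[OF \<open>F \<in> all_forests\<close>] that by (intro doubleton_in_M) blast
    then show ?thesis unfolding F_minus_def by auto
  qed
  have weight_eq: "weight p F = (\<Prod>e\<in>F_minus M0 F. a (fst e) (snd e))" if "F \<in> all_forests" for F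
    unfolding weight_def F_minus_eq[OF that] using edges[OF that]
    by (intro prod.cong refl) (auto simp: b_def)
  have "pfaffian n a = pfaffian n b"
    by (rule pfaffian_cong) (auto simp: b_def)
  \<comment> \<open>A sign squares to 1. One factor turns the Pfaffian into that of the listing
    \<open>ts\<close>, the other is absorbed by \<open>sign_matching_perm\<close>.\<close>
  also have "\<dots> = of_int (sign \<tau>) * (of_int (sign \<tau>) * pfaffian n b)"
    by (simp flip: mult.assoc of_int_mult)
  also have "of_int (sign \<tau>) * pfaffian n b = pf_list b (pairs p ts)"
    by (rule pf_list_permutation[OF ts \<tau>_def, symmetric])
  also have "\<dots> = pf_list form (map ((\<lambda>x. {#x#})(Min ?V := mset_set (insert (Min ?V) {}))) (pairs p ts))"
  proof -
    have "(\<lambda>x. {#x#})(Min ?V := mset_set (insert (Min ?V) {})) = (\<lambda>x. {#x#})"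
      by (intro fun_upd_idem) simp
    then show ?thesis by (simp add: pf_list_map form_def)
  qed
  also have "\<dots> = (\<Sum>F\<in>all_forests. orient_sign p ts F * weight p F)"
  proof (rule pf_list_eq_sum_forests[OF initial_state ts])
    fix x assume x: "x \<in> ?V"
    have "?R \<union> {} \<union> ?V = {1..n+r}" by auto
    then have "(\<Sum>y\<in>?R \<union> {} \<union> ?V. b x y) = (\<Sum>y\<in>{1..n+r}. a x y)"
      using x by (intro sum.cong) (auto simp: b_def)
    then show "(\<Sum>y\<in>?R \<union> {} \<union> ?V. b x y) = 0" using assms(5) x by auto
  qed
  also have "of_int (sign \<tau>) * \<dots> = (\<Sum>F\<in>all_forests. of_int (sign (matching_perm M0 F)) * weight p F)"
  proof -
    have "of_int (sign \<tau>) * orient_sign p ts F = of_int (sign (matching_perm M0 F))"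
      if "F \<in> all_forests" for F
      unfolding M0 by (rule sign_matching_perm[OF that refl ts \<tau>_def])
    then show ?thesis
      unfolding sum_distrib_left by (intro sum.cong refl) (simp only: flip: mult.assoc)
  qed
  also have "\<dots> = (\<Sum>F | spanning_forest ?V ?R a F \<and> compatible M0 F \<and> condition_C ?V ?R M0 F.
       of_int (sign (matching_perm M0 F)) * (\<Prod>e\<in>F_minus M0 F. a (fst e) (snd e)))"
  proof (rule sum.mono_neutral_cong_right)
    show "finite all_forests" by (rule finite_forests[OF initial_state])
    show sub: "{F. spanning_forest ?V ?R a F \<and> compatible M0 F \<and> condition_C ?V ?R M0 F} \<subseteq> all_forests"
    proof
      fix F assume F: "F \<in> {F. spanning_forest ?V ?R a F \<and> compatible M0 F \<and> condition_C ?V ?R M0 F}"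
      then have "F \<subseteq> ?V \<times> (?V \<union> ?R)"
        unfolding spanning_forest_def by fast
      then show "F \<in> all_forests"
        using F unfolding in_all_forests_iff spanning_forest_def M0 by blast
    qed
    show "of_int (sign (matching_perm M0 F)) * weight p F =
        of_int (sign (matching_perm M0 F)) * (\<Prod>e\<in>F_minus M0 F. a (fst e) (snd e))"
      if "F \<in> {F. spanning_forest ?V ?R a F \<and> compatible M0 F \<and> condition_C ?V ?R M0 F}" for F
      using weight_eq sub that by auto
    \<comment> \<open>A grown forest outside the index set must use an edge with a zero entry.
      Matching edges have nonzero entries, so this edge lies in \<open>F_minus M0 F\<close> and
      makes the weight vanish.\<close>
    show "\<forall>F\<in>all_forests - {F. spanning_forest ?V ?R a F \<and> compatible M0 F \<and> condition_C ?V ?R M0 F}.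
        of_int (sign (matching_perm M0 F)) * weight p F = 0"
    proof
      fix F assume F: "F \<in> all_forests - {F. spanning_forest ?V ?R a F \<and> compatible M0 F \<and> condition_C ?V ?R M0 F}"
      then have G: "F \<subseteq> ?V \<times> (?V \<union> ?R)" "acyclic F" "\<forall>x\<in>?V. \<exists>!y. (x, y) \<in> F"
          "compatible M0 F" "condition_C ?V ?R M0 F"
        using in_all_forests_iff M0 by auto
      have "\<forall>v\<in>?R. \<forall>w. (v, w) \<notin> F" using G(1) disjoint by blast
      then have "\<not> F \<subseteq> {(i, j). i \<in> ?V \<union> ?R \<and> j \<in> ?V \<union> ?R \<and> i \<noteq> j \<and> a i j \<noteq> 0}"
        using F G unfolding spanning_forest_def by blast
      moreover have "i \<noteq> j" if "(i, j) \<in> F" for i j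
        using G(2) that by (auto simp: acyclic_def)
      ultimately obtain i j where ij: "(i, j) \<in> F" "a i j = 0"
        using G(1) by blast
      then have "j \<noteq> p i" using p G(1) by blast
      then have "(i, j) \<in> F_minus M0 F" using ij(1) F F_minus_eq by auto
      moreover have "finite (F_minus M0 F)"
        using F F_minus_eq G(1) finite_VR by (auto intro: finite_subset[OF _ finite_subset[OF G(1)]])
      ultimately have "(\<Prod>e\<in>F_minus M0 F. a (fst e) (snd e)) = 0"
        using ij(2) by (intro prod_zero) (auto intro: bexI[of _ "(i, j)"])
      then have "weight p F = 0"
        using weight_eq F by simp
      then show "of_int (sign (matching_perm M0 F)) * weight p F = 0" by simp
    qed
  qed
  finally show ?thesis .
qed

end
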